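(* Let $R$ be an $n\times n$ nonnegative matrix with PF eigenvalue $1$, and let $u$ and $v$ be any corresponding left and right eigenvectors (for eigenvalue $1$). Let $\kappa=\min_i u_i v_i$, and if $\kappa>0$, let $u$ and $v$ be normalized so that $\langle u,v\rangle=1$. Then \[ \frac{1}{30}\cdot\frac{1-\mathrm{Re}\,\lambda_2(R)}{n+\ln\left(\frac{1}{\kappa}\right)}\leq\phi(R)\leq\sqrt{2\cdot\left(1-\mathrm{Re}\,\lambda_2(R)\right)}. \]
   Context: For a nonnegative square matrix $R$, its PF (Perron–Frobenius) eigenvalue is the nonnegative eigenvalue $r$ whose modulus is maximal among all eigenvalues (the spectral radius); "PF eigenvalue $1$" means $r=1$. The eigenvalues of $R$ are listed with multiplicity as $1=\lambda_1(R),\lambda_2(R),\dots,\lambda_n(R)$, where one copy of the PF eigenvalue $1$ is $\lambda_1$ and the remaining $n-1$ (nontrivial) eigenvalues are ordered by $\mathrm{Re}\,\lambda_2\geq\cdots\geq\mathrm{Re}\,\lambda_n$; so $\lambda_2(R)$ is a nontrivial eigenvalue of maximal real part. $\langle x,y\rangle=\sum_i \overline{x_i}y_i$. Edge expansion: if there do not exist left and right eigenvectors $u,v$ of $R$ for eigenvalue $1$ with all entries strictly positive, then $\phi(R)=0$. Otherwise, take any such positive $u,v$ normalized so that $\langle u,v\rangle=1$, and set \[ \phi(R)=\min_{\emptyset\neq S\subseteq[n],\ \sum_{i\in S}u_iv_i\leq\frac12}\ \frac{\sum_{i\in S,j\notin S}R_{i,j}u_iv_j}{\sum_{i\in S}u_iv_i}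 \] (this does not depend on the choice of $u,v$). *)

theory Defs
  imports "Jordan_Normal_Form.Spectral_Radius"
begin

definition nonneg_matrix :: "real mat \<Rightarrow> bool" where
  "nonneg_matrix R \<longleftrightarrow> (\<forall>i<dim_row R. \<forall>j<dim_col R. 0 \<le> R $$ (i, j))"

abbreviation cmat :: "real mat \<Rightarrow> complex mat" where
  "cmat R \<equiv> map_mat complex_of_real R"

definition PF_eigenvalue :: "real mat \<Rightarrow> real \<Rightarrow> bool" where
  "PF_eigenvalue R r \<longleftrightarrow>
     0 \<le> r \<and> eigenvalue (cmat R) (complex_of_real r) \<and> spectral_radius (cmat R) = r"

definition right_eigenvector :: "real mat \<Rightarrow> real vec \<Rightarrow> real \<Rightarrow> bool" where
  "right_eigenvector R v r \<longleftrightarrow> eigenvector R v r"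

definition left_eigenvector :: "real mat \<Rightarrow> real vec \<Rightarrow> real \<Rightarrow> bool" where
  "left_eigenvector R u r \<longleftrightarrow> eigenvector (transpose_mat R) u r"

(* All eigenvalues with algebraic multiplicity (roots of the characteristic polynomial), with one
   copy of the PF eigenvalue 1 first and the others by non-increasing real part. The list is
   0-based: ls ! 1 is the eigenvalue usually written lambda_2. *)
definition eigenvalue_listing :: "real mat \<Rightarrow> complex list \<Rightarrow> bool" where
  "eigenvalue_listing R ls \<longleftrightarrow>
     length ls = dim_row R \<and>
     char_poly (cmat R) = (\<Prod>a\<leftarrow>ls. [:- a, 1:]) \<and>
     ls ! 0 = 1 \<and>
     sorted_wrt (\<lambda>x y. Re x \<ge> Re y) (tl ls)"

definition positive_vec :: "real vec \<Rightarrow> bool" where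
  "positive_vec x \<longleftrightarrow> (\<forall>i<dim_vec x. 0 < x $ i)"

definition positive_eigenpair :: "real mat \<Rightarrow> real vec \<times> real vec \<Rightarrow> bool" where
  "positive_eigenpair R = (\<lambda>(u, v).
     left_eigenvector R u 1 \<and> right_eigenvector R v 1 \<and> positive_vec u \<and> positive_vec v)"

definition edge_expansion_wrt :: "real mat \<Rightarrow> real vec \<times> real vec \<Rightarrow> real" where
  "edge_expansion_wrt R = (\<lambda>(u, v).
     Min ((\<lambda>S. (\<Sum>i\<in>S. \<Sum>j\<in>{..<dim_row R} - S. R $$ (i, j) * u $ i * v $ j)
                / (\<Sum>i\<in>S. u $ i * v $ i)) `
          {S. S \<noteq> {} \<and> S \<subseteq> {..<dim_row R} \<and> (\<Sum>i\<in>S. u $ i * v $ i) \<le> 1 / 2}))"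

(* SOME renders the choice of an arbitrary normalized positive pair; the value does not depend
   on it. Such a pair exists as soon as any positive pair does, by rescaling. *)
definition edge_expansion :: "real mat \<Rightarrow> real" where
  "edge_expansion R =
     (if \<exists>p. positive_eigenpair R p
      then edge_expansion_wrt R (SOME p. positive_eigenpair R p \<and> fst p \<bullet> snd p = 1)
      else 0)"

end

theory Submission
  imports Defs
begin

text \<open>
  For a normalized positive eigenpair put \<open>\<pi>\<^sub>i = u\<^sub>i v\<^sub>i\<close> and \<open>Q\<^sub>i\<^sub>j = R\<^sub>i\<^sub>j u\<^sub>i v\<^sub>j\<close>. All row and column sums of
  \<open>Q\<close> are given by \<open>\<pi>\<close>, so \<open>P = Q / \<pi>\<close> is a Markov operator with stationary distribution \<open>\<pi>\<close>, similar to
  \<open>R\<close>, and the expansion of \<open>R\<close> is that of the circulation \<open>Q\<close>.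

  Upper bound: the real or imaginary part of an eigenfunction of mean zero for \<open>\<lambda>\<^sub>2\<close> has Rayleigh
  quotient at least \<open>Re \<lambda>\<^sub>2\<close>, and Cheeger's level set argument applies.

  Lower bound: the Euler steps \<open>(1 - t/k) + (t/k) P\<close>, iterated \<open>k\<close> times, keep at least the fraction
  \<open>1 - t \<phi>\<close> of the mass of an optimal set \<open>S\<close> inside \<open>S\<close>. On the other hand, in a \<open>\<pi>\<close>-orthonormal Schur
  basis \<open>I - P\<close> is upper triangular and accretive, which makes \<open>\<Sum>\<^sub>j 3\<^sup>j |x\<^sub>j|\<^sup>2\<close> decay at rate
  \<open>(1 - Re \<lambda>\<^sub>2) / 2\<close>; so functions of mean zero have contracted by a factor 2 at some time
  \<open>t = O(n / (1 - Re \<lambda>\<^sub>2))\<close>, whatever \<open>\<kappa>\<close> is.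

  If \<open>\<kappa> > 0\<close> and \<open>Re \<lambda>\<^sub>2 < 1\<close>, a positive eigenpair exists, since \<open>v\<close> then has constant sign.
\<close>

section \<open>Cheeger inequality for circulations\<close>

text \<open>The chain \<open>P\<close> need not be reversible, so it may be far from normal, and its
  eigenvalues alone do not tell when its powers start to contract. A Schur basis shows the
  eigenvalues on the diagonal, but the entries above it can delay the decay. What limits this delay
  is accretivity of I - P, a consequence of the equal marginals of \<open>Q\<close>. Only real parts
  of eigenvalues are controlled: an eigenvalue -1 keeps the powers of \<open>P\<close> from decaying
  but is harmless for small steps towards \<open>P\<close>, which is why Euler steps replace powers.
  The weighted norm differs from the plain one by a factor up to 3^n, and the time needed to make up
  for this factor is the source of n in the bound. No lower bound on \<pi> is used along the way.
  The resulting estimate is (1 - Re \<lambda>) / (28 n) with \<lambda> = \<open>ls ! 1\<close>, and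
  the stated one follows because \<kappa> \<le> 1.\<close>

text \<open>Weights may vanish, since the edge weights \<open>Q i j\<close> are among them. Hence
  \<open>B = 0\<close> does not force \<open>b\<close> to vanish and is a case of its own.\<close>

lemma weighted_Cauchy_Schwarz:
  fixes a b w :: "'i \<Rightarrow> real"
  assumes fin: "finite I" and w: "\<And>i. i \<in> I \<Longrightarrow> 0 \<le> w i"
  shows "(\<Sum>i\<in>I. w i * a i * b i)\<^sup>2 \<le> (\<Sum>i\<in>I. w i * (a i)\<^sup>2) * (\<Sum>i\<in>I. w i * (b i)\<^sup>2)"
proof -
  define A where "A = (\<Sum>i\<in>I. w i * (a i)\<^sup>2)"
  define B where "B = (\<Sum>i\<in>I. w i * (b i)\<^sup>2)"
  define Z where "Z = (\<Sum>i\<in>I. w i * a i * b i)"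
  have B0: "0 \<le> B" unfolding B_def by (intro sum_nonneg) (simp add: w)
  show ?thesis
  proof (cases "B = 0")
    case True
    have "w i * (b i)\<^sup>2 = 0" if "i \<in> I" for i
      using True that fin w unfolding B_def by (subst (asm) sum_nonneg_eq_0_iff) auto
    then have "w i * a i * b i = 0" if "i \<in> I" for i using that by fastforce
    then have "Z = 0" unfolding Z_def by (intro sum.neutral) auto
    then show ?thesis using True by (simp add: Z_def B_def)
  next
    case False
    have "0 \<le> (\<Sum>i\<in>I. w i * (a i * B - b i * Z)\<^sup>2)"
      by (intro sum_nonneg) (simp add: w)
    also have "\<dots> = (\<Sum>i\<in>I. B\<^sup>2 * (w i * (a i)\<^sup>2) - 2 * B * Z * (w i * a i * b i)
        + Z\<^sup>2 * (w i * (b i)\<^sup>2))"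
      by (intro sum.cong refl) (simp add: power2_eq_square algebra_simps)
    also have "\<dots> = B\<^sup>2 * A - 2 * B * Z * Z + Z\<^sup>2 * B"
      unfolding A_def B_def Z_def by (simp add: sum.distrib sum_subtractf sum_distrib_left)
    also have "\<dots> = B * (A * B - Z\<^sup>2)" by (simp add: power2_eq_square algebra_simps)
    finally have "0 \<le> A * B - Z\<^sup>2"
      using B0 False by (simp add: zero_le_mult_iff)
    then show ?thesis by (simp add: A_def B_def Z_def)
  qed
qed

text \<open>\<open>Q\<close> is the stationary flow of a Markov chain on n states. Both marginals
  are \<pi>, but \<open>Q\<close> is not assumed symmetric.\<close>

locale circulation =
  fixes n :: nat and Q :: "nat \<Rightarrow> nat \<Rightarrow> real" and \<pi> :: "nat \<Rightarrow> real"
  assumes Q_nonneg: "\<And>i j. i < n \<Longrightarrow> j < n \<Longrightarrow> 0 \<le> Q i j"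
    and row_sum: "\<And>i. i < n \<Longrightarrow> (\<Sum>j<n. Q i j) = \<pi> i"
    and col_sum: "\<And>j. j < n \<Longrightarrow> (\<Sum>i<n. Q i j) = \<pi> j"
    and \<pi>_pos: "\<And>i. i < n \<Longrightarrow> 0 < \<pi> i"
    and \<pi>_total: "(\<Sum>i<n. \<pi> i) = 1"
begin

definition flow :: "nat set \<Rightarrow> real" where
  "flow S = (\<Sum>i\<in>S. \<Sum>j\<in>{..<n} - S. Q i j)"

definition dirichlet :: "(nat \<Rightarrow> real) \<Rightarrow> real" where
  "dirichlet f = (\<Sum>i<n. \<Sum>j<n. Q i j * (f i - f j)\<^sup>2)"

lemma row_weighted: "(\<Sum>i<n. \<Sum>j<n. Q i j * f i) = (\<Sum>i<n. \<pi> i * f i)"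
  by (intro sum.cong refl) (simp add: sum_distrib_right[symmetric] row_sum)

lemma col_weighted: "(\<Sum>i<n. \<Sum>j<n. Q i j * f j) = (\<Sum>i<n. \<pi> i * f i)"
  by (subst sum.swap, intro sum.cong refl) (simp add: sum_distrib_right[symmetric] col_sum)

lemma dirichlet_nonneg: "0 \<le> dirichlet f"
  unfolding dirichlet_def by (intro sum_nonneg) (simp add: Q_nonneg)

text \<open>Equal marginals turn both diagonal terms of the square into the same \<pi>-sum, so the
  energy determines the Rayleigh quotient even without reversibility. The factor 2 comes from
  summing over ordered pairs.\<close>

lemma dirichlet_eq:
  "dirichlet f = 2 * ((\<Sum>i<n. \<pi> i * (f i)\<^sup>2) - (\<Sum>i<n. \<Sum>j<n. Q i j * f i * f j))"
proof -
  have "dirichlet f = (\<Sum>i<n. \<Sum>j<n. Q i j * (f i)\<^sup>2 + Q i j * (f j)\<^sup>2 - 2 * (Q i j * f i * f j))"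
    unfolding dirichlet_def by (intro sum.cong refl) (simp add: power2_eq_square algebra_simps)
  also have "\<dots> = (\<Sum>i<n. \<pi> i * (f i)\<^sup>2) + (\<Sum>i<n. \<pi> i * (f i)\<^sup>2)
      - 2 * (\<Sum>i<n. \<Sum>j<n. Q i j * f i * f j)"
    by (simp add: sum.distrib sum_subtractf sum_distrib_left row_weighted col_weighted)
  finally show ?thesis by simp
qed

lemma flow_nonneg:
  assumes "S \<subseteq> {..<n}"
  shows "0 \<le> flow S"
  unfolding flow_def using assms by (intro sum_nonneg Q_nonneg) auto

lemma mass_pos:
  assumes "S \<subseteq> {..<n}" "S \<noteq> {}"
  shows "0 < sum \<pi> S"
  using assms finite_subset[OF assms(1)] by (intro sum_pos) (auto intro: \<pi>_pos)

text \<open>A layer-cake argument by peeling. Lowering \<open>h\<close> by its least positive value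
  \<open>m\<close> on its support \<open>S\<close> removes \<open>m * sum \<pi> S\<close> from the
  left sum and \<open>m * flow S\<close> from the right one, and the support shrinks, so induction
  on its size applies.\<close>

lemma coarea:
  fixes h :: "nat \<Rightarrow> real"
  assumes "\<And>i. i < n \<Longrightarrow> 0 \<le> h i"
    and "\<And>T. T \<noteq> {} \<Longrightarrow> T \<subseteq> {i. i < n \<and> 0 < h i} \<Longrightarrow> \<phi> * sum \<pi> T \<le> flow T"
  shows "\<phi> * (\<Sum>i<n. \<pi> i * h i) \<le> (\<Sum>i<n. \<Sum>j<n. Q i j * max (h i - h j) 0)"
  using assms
proof (induction "card {i. i < n \<and> 0 < h i}" arbitrary: h rule: less_induct)
  case less
  define S where "S = {i. i < n \<and> 0 < h i}"
  have S: "S \<subseteq> {..<n}" and finS: "finite S" by (auto simp: S_def)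
  have zero: "h i = 0" if "i < n" "i \<notin> S" for i
    using that less.prems(1)[of i] by (auto simp: S_def)
  show ?case
  proof (cases "S = {}")
    case True
    then have "\<pi> i * h i = 0" if "i < n" for i using zero that by auto
    then have "(\<Sum>i<n. \<pi> i * h i) = 0" by (intro sum.neutral) auto
    moreover have "0 \<le> (\<Sum>i<n. \<Sum>j<n. Q i j * max (h i - h j) 0)"
      by (intro sum_nonneg) (simp add: Q_nonneg)
    ultimately show ?thesis by simp
  next
    case False
    define m where "m = Min (h ` S)"
    have m_le: "m \<le> h i" if "i \<in> S" for i using that finS by (simp add: m_def)
    have "m \<in> h ` S" unfolding m_def using False finS by (intro Min_in) auto
    then obtain i0 where i0: "i0 \<in> S" "h i0 = m" by auto
    have m: "0 < m" using i0 by (auto simp: S_def)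
    define h' where "h' i = (if i \<in> S then h i - m else 0)" for i
    have sub: "{i. i < n \<and> 0 < h' i} \<subseteq> S" by (auto simp: h'_def split: if_splits)
    moreover have "i0 \<in> S - {i. i < n \<and> 0 < h' i}" using i0 by (auto simp: h'_def)
    ultimately have "{i. i < n \<and> 0 < h' i} \<subset> S" by blast
    then have card: "card {i. i < n \<and> 0 < h' i} < card {i. i < n \<and> 0 < h i}"
      using psubset_card_mono[OF finS] unfolding S_def by blast
    have IH: "\<phi> * (\<Sum>i<n. \<pi> i * h' i) \<le> (\<Sum>i<n. \<Sum>j<n. Q i j * max (h' i - h' j) 0)"
    proof (rule less.hyps[OF card])
      show "0 \<le> h' i" if "i < n" for i using m_le by (auto simp: h'_def)
      show "\<phi> * sum \<pi> T \<le> flow T" if "T \<noteq> {}" "T \<subseteq> {i. i < n \<and> 0 < h' i}" for T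
        using less.prems(2)[OF that(1)] that(2) sub unfolding S_def by blast
    qed
    have "(\<Sum>i<n. \<pi> i * h i) = (\<Sum>i<n. \<pi> i * h' i + m * (if i \<in> S then \<pi> i else 0))"
      by (intro sum.cong refl) (auto simp: h'_def zero algebra_simps)
    also have "\<dots> = (\<Sum>i<n. \<pi> i * h' i) + m * sum \<pi> S"
      using S by (simp add: sum.distrib sum_distrib_left[symmetric] sum.inter_restrict[symmetric]
          Int_absorb1)
    finally have e1: "(\<Sum>i<n. \<pi> i * h i) = (\<Sum>i<n. \<pi> i * h' i) + m * sum \<pi> S" .
    \<comment> \<open>Only edges leaving \<open>S\<close> are affected: inside \<open>S\<close> both
      ends drop by \<open>m\<close>, and for \<open>i\<close> outside \<open>S\<close> there is no
      positive difference at all.\<close>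
    have pt: "Q i j * max (h i - h j) 0
        = Q i j * max (h' i - h' j) 0 + m * (if i \<in> S then if j \<in> {..<n} - S then Q i j else 0 else 0)"
      if "i < n" "j < n" for i j
      using that m m_le[of i] m_le[of j] zero[of i] zero[of j]
      by (auto simp: h'_def max_def algebra_simps)
    have "(\<Sum>i<n. \<Sum>j<n. Q i j * max (h i - h j) 0)
      = (\<Sum>i<n. \<Sum>j<n. Q i j * max (h' i - h' j) 0)
       + m * (\<Sum>i<n. \<Sum>j<n. if i \<in> S then if j \<in> {..<n} - S then Q i j else 0 else 0)"
      by (simp add: pt sum.distrib sum_distrib_left)
    also have "(\<Sum>i<n. \<Sum>j<n. if i \<in> S then if j \<in> {..<n} - S then Q i j else 0 else 0)
      = (\<Sum>i<n. if i \<in> S then (\<Sum>j<n. if j \<in> {..<n} - S then Q i j else 0) else 0)"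
      by (intro sum.cong refl) auto
    also have "\<dots> = flow S"
      unfolding flow_def using S
      by (subst sum.inter_restrict[symmetric], simp)+
         (simp add: Int_absorb1 Int_absorb2 Diff_subset)
    finally have e2: "(\<Sum>i<n. \<Sum>j<n. Q i j * max (h i - h j) 0)
      = (\<Sum>i<n. \<Sum>j<n. Q i j * max (h' i - h' j) 0) + m * flow S" .
    have "m * (\<phi> * sum \<pi> S) \<le> m * flow S"
      using less.prems(2)[OF False] m by (simp add: S_def)
    then show ?thesis unfolding e1 e2 using IH by (simp add: algebra_simps)
  qed
qed

text \<open>A support of mass at most 1/2 makes every level set of \<open>g\<close> a competitor for
  \<phi>, so the coarea inequality applies to the square of \<open>g\<close>. Cauchy-Schwarz then
  separates |g i - g j| from g i + g j.\<close>

lemma cheeger_restricted: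
  assumes g: "\<And>i. i < n \<Longrightarrow> 0 \<le> g i" and N: "0 < (\<Sum>i<n. \<pi> i * (g i)\<^sup>2)"
    and half: "sum \<pi> {i. i < n \<and> 0 < g i} \<le> 1 / 2"
    and \<phi>: "\<And>T. T \<noteq> {} \<Longrightarrow> T \<subseteq> {..<n} \<Longrightarrow> sum \<pi> T \<le> 1 / 2 \<Longrightarrow> \<phi> * sum \<pi> T \<le> flow T"
    and \<phi>0: "0 \<le> \<phi>"
    and E: "dirichlet g \<le> 2 * \<epsilon> * (\<Sum>i<n. \<pi> i * (g i)\<^sup>2)"
  shows "\<phi>\<^sup>2 \<le> 2 * \<epsilon>"
proof -
  define N where "N = (\<Sum>i<n. \<pi> i * (g i)\<^sup>2)"
  define K where "K = (\<Sum>i<n. \<Sum>j<n. Q i j * \<bar>g i - g j\<bar> * (g i + g j))"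
  have "\<phi> * N \<le> (\<Sum>i<n. \<Sum>j<n. Q i j * max ((g i)\<^sup>2 - (g j)\<^sup>2) 0)"
    unfolding N_def
  proof (rule coarea)
    fix T assume T: "T \<noteq> {}" "T \<subseteq> {i. i < n \<and> 0 < (g i)\<^sup>2}"
    then have sub: "T \<subseteq> {i. i < n \<and> 0 < g i}" using g by force
    have "sum \<pi> T \<le> sum \<pi> {i. i < n \<and> 0 < g i}"
      using sub \<pi>_pos by (intro sum_mono2) (auto intro: less_imp_le)
    then show "\<phi> * sum \<pi> T \<le> flow T" using \<phi>[OF T(1)] half sub by auto
  qed simp
  \<comment> \<open>From 2 max(x, 0) = |x| + x. The signed part will sum to zero, as both marginals
    of \<open>Q\<close> agree.\<close>
  also have "\<dots> = (\<Sum>i<n. \<Sum>j<n. (Q i j * \<bar>g i - g j\<bar> * (g i + g j)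
      + Q i j * (g i)\<^sup>2 - Q i j * (g j)\<^sup>2) / 2)"
  proof (intro sum.cong refl)
    fix i j assume "i \<in> {..<n}" "j \<in> {..<n}"
    then have "0 \<le> g i" "0 \<le> g j" using g by auto
    then have "\<bar>g i - g j\<bar> * (g i + g j) = \<bar>(g i)\<^sup>2 - (g j)\<^sup>2\<bar>"
      by (simp add: square_diff_square_factored power2_eq_square abs_mult mult.commute)
    moreover have "2 * max x 0 = \<bar>x\<bar> + x" for x :: real by (simp add: max_def)
    ultimately have "2 * max ((g i)\<^sup>2 - (g j)\<^sup>2) 0 = \<bar>g i - g j\<bar> * (g i + g j) + ((g i)\<^sup>2 - (g j)\<^sup>2)"
      by metis
    then have "Q i j * (2 * max ((g i)\<^sup>2 - (g j)\<^sup>2) 0)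
        = Q i j * (\<bar>g i - g j\<bar> * (g i + g j) + ((g i)\<^sup>2 - (g j)\<^sup>2))"
      by presburger
    then show "Q i j * max ((g i)\<^sup>2 - (g j)\<^sup>2) 0 = (Q i j * \<bar>g i - g j\<bar> * (g i + g j)
        + Q i j * (g i)\<^sup>2 - Q i j * (g j)\<^sup>2) / 2"
      by (simp add: algebra_simps)
  qed
  also have "\<dots> = K / 2"
    unfolding K_def
    by (simp add: sum_divide_distrib[symmetric] sum.distrib sum_subtractf row_weighted col_weighted)
  finally have le: "2 * (\<phi> * N) \<le> K" by simp
  have "K\<^sup>2 \<le> dirichlet g * (\<Sum>i<n. \<Sum>j<n. Q i j * (g i + g j)\<^sup>2)"
    using weighted_Cauchy_Schwarz[of "{..<n} \<times> {..<n}" "\<lambda>(i, j). Q i j"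
        "\<lambda>(i, j). \<bar>g i - g j\<bar>" "\<lambda>(i, j). g i + g j"]
    unfolding K_def dirichlet_def
    by (auto simp: sum.cartesian_product case_prod_beta Q_nonneg)
  also have "(\<Sum>i<n. \<Sum>j<n. Q i j * (g i + g j)\<^sup>2) = 4 * N - dirichlet g"
  proof -
    have "(\<Sum>i<n. \<Sum>j<n. Q i j * (g i + g j)\<^sup>2)
      = (\<Sum>i<n. \<Sum>j<n. 2 * (Q i j * (g i)\<^sup>2) + 2 * (Q i j * (g j)\<^sup>2) - Q i j * (g i - g j)\<^sup>2)"
      by (intro sum.cong refl) (simp add: power2_eq_square algebra_simps)
    also have "\<dots> = 2 * N + 2 * N - dirichlet g"
      unfolding N_def dirichlet_def
      by (simp add: sum.distrib sum_subtractf sum_distrib_left[symmetric] row_weighted col_weighted)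
    finally show ?thesis by simp
  qed
  also have "dirichlet g * (4 * N - dirichlet g) \<le> dirichlet g * (4 * N)"
    by (intro mult_left_mono) (simp_all add: dirichlet_nonneg)
  also have "\<dots> \<le> (2 * \<epsilon> * N) * (4 * N)"
    using E N unfolding N_def by (intro mult_right_mono) auto
  finally have K2: "K\<^sup>2 \<le> 8 * \<epsilon> * N\<^sup>2" by (simp add: power2_eq_square)
  have N0: "0 < N" using N by (simp add: N_def)
  have "(2 * (\<phi> * N))\<^sup>2 \<le> K\<^sup>2"
    using le \<phi>0 N0 by (intro power_mono) auto
  with K2 have "\<phi>\<^sup>2 * (4 * N\<^sup>2) \<le> (2 * \<epsilon>) * (4 * N\<^sup>2)"
    by (simp add: power_mult_distrib algebra_simps)
  then show ?thesis using N0 by (simp add: mult_le_cancel_right)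
qed

lemma median_exists:
  fixes f :: "nat \<Rightarrow> real"
  obtains c where "sum \<pi> {i. i < n \<and> c < f i} \<le> 1 / 2" "sum \<pi> {i. i < n \<and> f i < c} \<le> 1 / 2"
proof -
  have n0: "n \<noteq> 0" using \<pi>_total by (cases n) auto
  define C where "C = {c \<in> f ` {..<n}. sum \<pi> {i. i < n \<and> c < f i} \<le> 1 / 2}"
  have finC: "finite C" by (simp add: C_def)
  have "\<not> Max (f ` {..<n}) < f i" if "i < n" for i
    using that by (intro leD Max_ge) auto
  then have "{i. i < n \<and> Max (f ` {..<n}) < f i} = {}" by blast
  then have "sum \<pi> {i. i < n \<and> Max (f ` {..<n}) < f i} = 0" by (simp only: sum.empty)
  moreover have "Max (f ` {..<n}) \<in> f ` {..<n}" using n0 by (intro Max_in) auto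
  ultimately have "Max (f ` {..<n}) \<in> C" unfolding C_def by (intro CollectI conjI) simp_all
  then have "C \<noteq> {}" by auto
  define c where "c = Min C"
  have cC: "c \<in> C" unfolding c_def using finC \<open>C \<noteq> {}\<close> by (rule Min_in)
  have "sum \<pi> {i. i < n \<and> f i < c} \<le> 1 / 2"
  proof (rule ccontr)
    assume neg: "\<not> ?thesis"
    define B where "B = {i. i < n \<and> f i < c}"
    have B: "finite B" "B \<noteq> {}" using neg by (auto simp: B_def simp del: Collect_empty_eq)
    \<comment> \<open>The next smaller value of \<open>f\<close> would qualify too: what lies above
      it is exactly the complement of \<open>B\<close>, whose mass is below 1/2. This contradicts
      the minimality of \<open>c\<close>.\<close>
    define c' where "c' = Max (f ` B)"
    have "c' \<in> f ` B" unfolding c'_def using B by (intro Max_in) auto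
    then have c': "c' < c" "c' \<in> f ` {..<n}" by (auto simp: B_def)
    have "f i \<le> c'" if "i \<in> B" for i using that B by (simp add: c'_def)
    then have eq: "{i. i < n \<and> c' < f i} = {..<n} - B"
      using c' by (force simp: B_def)
    have "sum \<pi> ({..<n} - B) = 1 - sum \<pi> B"
      using \<pi>_total by (subst sum_diff) (auto simp: B_def)
    then have "c' \<in> C" using neg c' by (simp add: C_def eq B_def)
    then have "c \<le> c'" unfolding c_def using finC by simp
    then show False using c' by simp
  qed
  then show ?thesis using that cC by (auto simp: C_def)
qed

text \<open>Cutting \<open>f\<close> at a median leaves two nonnegative parts, each supported on at
  most half the mass. Their energies add up to at most that of \<open>f\<close> and their squared
  norms to at least that of \<open>f\<close>, so one of them inherits the quotient.\<close>

theorem cheeger: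
  assumes mean: "(\<Sum>i<n. \<pi> i * f i) = 0" and nz: "\<exists>i<n. f i \<noteq> 0"
    and \<phi>: "\<And>T. T \<noteq> {} \<Longrightarrow> T \<subseteq> {..<n} \<Longrightarrow> sum \<pi> T \<le> 1 / 2 \<Longrightarrow> \<phi> * sum \<pi> T \<le> flow T"
    and \<phi>0: "0 \<le> \<phi>"
    and R: "(1 - \<epsilon>) * (\<Sum>i<n. \<pi> i * (f i)\<^sup>2) \<le> (\<Sum>i<n. \<Sum>j<n. Q i j * f i * f j)"
  shows "\<phi>\<^sup>2 \<le> 2 * \<epsilon>"
proof -
  obtain c where c: "sum \<pi> {i. i < n \<and> c < f i} \<le> 1 / 2" "sum \<pi> {i. i < n \<and> f i < c} \<le> 1 / 2"
    by (rule median_exists)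
  define g where "g i = max (f i - c) 0" for i
  define h where "h i = max (c - f i) 0" for i
  let ?N = "\<lambda>f. \<Sum>i<n. \<pi> i * (f i)\<^sup>2"
  have N0: "0 \<le> ?N f" for f by (intro sum_nonneg) (simp add: \<pi>_pos less_imp_le)
  have Nz: "f i = 0" if "?N f = 0" "i < n" for f i
  proof -
    have "\<pi> i * (f i)\<^sup>2 = 0"
      using that \<pi>_pos by (subst (asm) sum_nonneg_eq_0_iff) (auto simp: less_imp_le)
    then show ?thesis using \<pi>_pos[OF that(2)] by simp
  qed
  have "?N f \<noteq> 0" using Nz[of f] nz by blast
  then have Nf: "0 < ?N f" using N0[of f] by linarith
  have Ef: "dirichlet f \<le> 2 * \<epsilon> * ?N f"
    using R unfolding dirichlet_eq by (simp add: algebra_simps)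
  have "0 \<le> 2 * \<epsilon> * ?N f" by (rule order_trans[OF dirichlet_nonneg Ef])
  then have \<epsilon>: "0 \<le> \<epsilon>" using Nf by (simp add: zero_le_mult_iff)
  have "?N g + ?N h = (\<Sum>i<n. \<pi> i * (f i)\<^sup>2 + \<pi> i * c\<^sup>2 - 2 * c * (\<pi> i * f i))"
    unfolding sum.distrib[symmetric]
    by (intro sum.cong refl) (auto simp: g_def h_def max_def power2_eq_square algebra_simps)
  also have "\<dots> = ?N f + c\<^sup>2"
    by (simp add: sum.distrib sum_subtractf sum_distrib_left[symmetric]
        sum_distrib_right[symmetric] mean \<pi>_total)
  finally have Ngh: "?N f \<le> ?N g + ?N h" by simp
  have "dirichlet g + dirichlet h \<le> dirichlet f"
    unfolding dirichlet_def sum.distrib[symmetric]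
  proof (intro sum_mono)
    fix i j assume ij: "i \<in> {..<n}" "j \<in> {..<n}"
    have *: "f i - f j = (g i - g j) - (h i - h j)" by (simp add: g_def h_def max_def)
    \<comment> \<open>\<open>g\<close> and \<open>h\<close> have disjoint supports, so the mixed
      term can only add energy to \<open>f\<close>.\<close>
    have "(g i - g j) * (h i - h j) = - (g i * h j + g j * h i)"
      by (auto simp: g_def h_def max_def algebra_simps)
    also have "0 \<le> g i * h j + g j * h i" by (simp add: g_def h_def)
    then have "- (g i * h j + g j * h i) \<le> 0" by linarith
    finally have "(g i - g j)\<^sup>2 + (h i - h j)\<^sup>2 \<le> (f i - f j)\<^sup>2"
      unfolding * power2_diff[of "g i - g j" "h i - h j"] by linarith
    then show "Q i j * (g i - g j)\<^sup>2 + Q i j * (h i - h j)\<^sup>2 \<le> Q i j * (f i - f j)\<^sup>2"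
      using Q_nonneg ij by (simp add: distrib_left[symmetric] mult_left_mono)
  qed
  also have "\<dots> \<le> 2 * \<epsilon> * (?N g + ?N h)"
    using \<epsilon> Ngh by (intro order_trans[OF Ef] mult_left_mono) auto
  finally have sum_le: "dirichlet g + dirichlet h \<le> 2 * \<epsilon> * ?N g + 2 * \<epsilon> * ?N h"
    by (simp add: algebra_simps)
  have res: "\<phi>\<^sup>2 \<le> 2 * \<epsilon>"
    if "\<And>i. 0 \<le> k i" "{i. i < n \<and> 0 < k i} = {i. i < n \<and> c < f i} \<or>
       {i. i < n \<and> 0 < k i} = {i. i < n \<and> f i < c}" "0 < ?N k" "dirichlet k \<le> 2 * \<epsilon> * ?N k" for k
    by (rule cheeger_restricted[of k]) (use that c \<phi> \<phi>0 in auto)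
  have g: "{i. i < n \<and> 0 < g i} = {i. i < n \<and> c < f i}" by (auto simp: g_def)
  have h: "{i. i < n \<and> 0 < h i} = {i. i < n \<and> f i < c}" by (auto simp: h_def)
  have gh0: "0 \<le> g i" "0 \<le> h i" for i by (auto simp: g_def h_def)
  show ?thesis
  \<comment> \<open>Positivity of the norm belongs to the case distinction, because one of the parts
    may vanish identically.\<close>
  proof (cases "0 < ?N g \<and> dirichlet g \<le> 2 * \<epsilon> * ?N g")
    case True
    then show ?thesis using res[of g] g gh0 by blast
  next
    case False
    have "dirichlet h \<le> 2 * \<epsilon> * ?N h \<and> 0 < ?N h"
    proof (cases "0 < ?N g")
      case True
      then have "2 * \<epsilon> * ?N g < dirichlet g" using False by simp
      then have lt: "dirichlet h < 2 * \<epsilon> * ?N h" using sum_le by linarith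
      then have "?N h \<noteq> 0" using dirichlet_nonneg[of h] by auto
      then show ?thesis using lt N0[of h] by linarith
    next
      case False
      then have "?N g = 0" using N0[of g] by linarith
      then show ?thesis using sum_le Ngh Nf dirichlet_nonneg[of g] by simp
    qed
    then show ?thesis using res[of h] h gh0 by blast
  qed
qed

end

section \<open>Unitary triangularization in a weighted inner product\<close>

definition weighted_ip :: "nat \<Rightarrow> (nat \<Rightarrow> real) \<Rightarrow> (nat \<Rightarrow> complex) \<Rightarrow> (nat \<Rightarrow> complex) \<Rightarrow> complex" where
  "weighted_ip n w f g = (\<Sum>i<n. of_real (w i) * cnj (f i) * g i)"

lemma weighted_ip_sum_right:
  "weighted_ip n w f (\<lambda>i. \<Sum>l\<in>I. c l * g l i) = (\<Sum>l\<in>I. c l * weighted_ip n w f (g l))"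
  unfolding weighted_ip_def sum_distrib_left
  by (subst sum.swap) (simp add: mult_ac)

lemma weighted_ip_diff_right:
  "weighted_ip n w f (\<lambda>i. g i - h i) = weighted_ip n w f g - weighted_ip n w f h"
  by (simp add: weighted_ip_def algebra_simps sum_subtractf)

lemma weighted_ip_cnj: "cnj (weighted_ip n w f g) = weighted_ip n w g f"
  by (simp add: weighted_ip_def mult_ac)

lemma weighted_ip_cong:
  assumes "\<And>i. i < n \<Longrightarrow> f i = f' i" "\<And>i. i < n \<Longrightarrow> g i = g' i"
  shows "weighted_ip n w f g = weighted_ip n w f' g'"
  unfolding weighted_ip_def using assms by (intro sum.cong) auto

lemma weighted_ip_self:
  "weighted_ip n w f f = of_real (\<Sum>i<n. w i * (cmod (f i))\<^sup>2)"
  unfolding weighted_ip_def of_real_sum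
  by (intro sum.cong refl) (simp add: complex_norm_square mult_ac del: of_real_power)

lemma weighted_ip_self_pos:
  fixes w :: "nat \<Rightarrow> real" and f :: "nat \<Rightarrow> complex"
  assumes w: "\<And>i. i < n \<Longrightarrow> 0 < w i" and "i < n" "f i \<noteq> 0"
  shows "0 < (\<Sum>i<n. w i * (cmod (f i))\<^sup>2)"
proof (rule sum_pos2[of _ i])
  show "0 < w i * (cmod (f i))\<^sup>2" using assms by simp
  show "0 \<le> w j * (cmod (f j))\<^sup>2" if "j \<in> {..<n}" for j
    using w[of j] that by simp
qed (use assms in auto)

text \<open>Gram-Schmidt without normalization, on all indices; a vector of norm zero contributes
  nothing, by division by zero. As a simp rule the unconditional recursive equation would unfold
  forever.\<close>

fun gso :: "nat \<Rightarrow> (nat \<Rightarrow> real) \<Rightarrow> (nat \<Rightarrow> nat \<Rightarrow> complex) \<Rightarrow> nat \<Rightarrow> nat \<Rightarrow> complex" where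
  "gso n w p j = (\<lambda>i. p j i - (\<Sum>l<j. weighted_ip n w (gso n w p l) (p j)
      / weighted_ip n w (gso n w p l) (gso n w p l) * gso n w p l i))"

declare gso.simps [simp del]

text \<open>Independence of the \<open>p j\<close> enters through the dual family: pairing with
  \<open>Y k\<close> kills the orthogonalized vectors before \<open>k\<close> and gives 1 at
  \<open>k\<close>, so none of them is zero. The coefficients \<open>C\<close> are triangular, which
  preserves the flag of spans.\<close>

lemma orthonormal_flag:
  fixes p Y :: "nat \<Rightarrow> nat \<Rightarrow> complex" and w :: "nat \<Rightarrow> real"
  assumes w: "\<And>i. i < n \<Longrightarrow> 0 < w i"
    and dual: "\<And>j l. j < n \<Longrightarrow> l < n \<Longrightarrow> (\<Sum>i<n. Y j i * p l i) = (if j = l then 1 else 0)"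
  shows "\<exists>e C. (\<forall>j<n. \<forall>l<n. weighted_ip n w (e j) (e l) = (if j = l then 1 else 0))
    \<and> (\<forall>i j. p j i = (\<Sum>l\<le>j. C l j * e l i)) \<and> (\<forall>j<n. C j j \<noteq> 0)"
proof -
  define q where "q = gso n w p"
  define c where "c l j = weighted_ip n w (q l) (p j) / weighted_ip n w (q l) (q l)" for l j
  have q: "q j i = p j i - (\<Sum>l<j. c l j * q l i)" for i j
    unfolding q_def c_def by (subst gso.simps) simp
  have Yq: "(\<Sum>i<n. Y k i * q j i) = (if k = j then 1 else 0)" if "j \<le> k" "k < n" for j k
    using that
  proof (induction j rule: less_induct)
    case (less j)
    have "(\<Sum>i<n. Y k i * q j i) = (\<Sum>i<n. Y k i * p j i) - (\<Sum>l<j. c l j * (\<Sum>i<n. Y k i * q l i))"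
      unfolding q[of j] sum_distrib_left right_diff_distrib sum_subtractf
      by (subst sum.swap) (simp add: mult_ac)
    also have "(\<Sum>l<j. c l j * (\<Sum>i<n. Y k i * q l i)) = 0"
      using less by (intro sum.neutral) auto
    finally show ?case using dual less.prems by simp
  qed
  define N where "N j = (\<Sum>i<n. w i * (cmod (q j i))\<^sup>2)" for j
  have N: "weighted_ip n w (q j) (q j) = of_real (N j)" for j
    unfolding N_def by (rule weighted_ip_self)
  have Npos: "0 < N j" if "j < n" for j
  proof -
    have "\<exists>i<n. q j i \<noteq> 0"
    proof (rule ccontr)
      assume "\<not> ?thesis"
      then have "(\<Sum>i<n. Y j i * q j i) = 0" by (intro sum.neutral) auto
      then show False using Yq[of j j] that by simp
    qed
    then show ?thesis unfolding N_def using w by (auto intro: weighted_ip_self_pos)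
  qed
  have orth: "weighted_ip n w (q l) (q j) = 0" if "l < j" "j < n" for l j
    using that
  proof (induction j arbitrary: l rule: less_induct)
    case (less j)
    have "weighted_ip n w (q l) (q j)
        = weighted_ip n w (q l) (p j) - (\<Sum>m<j. c m j * weighted_ip n w (q l) (q m))"
      unfolding q[of j] weighted_ip_diff_right weighted_ip_sum_right ..
    also have "(\<Sum>m<j. c m j * weighted_ip n w (q l) (q m))
        = (\<Sum>m<j. if m = l then c l j * weighted_ip n w (q l) (q l) else 0)"
    proof (intro sum.cong refl)
      fix m assume m: "m \<in> {..<j}"
      consider "m = l" | "l < m" | "m < l" by linarith
      then show "c m j * weighted_ip n w (q l) (q m)
          = (if m = l then c l j * weighted_ip n w (q l) (q l) else 0)"
      proof cases
        case 3
        then have "weighted_ip n w (q m) (q l) = 0" using less by simp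
        then have "weighted_ip n w (q l) (q m) = 0"
          by (metis complex_cnj_zero weighted_ip_cnj)
        then show ?thesis using 3 by simp
      qed (use less m in auto)
    qed
    also have "\<dots> = c l j * weighted_ip n w (q l) (q l)"
      using less.prems by (simp add: sum.delta)
    also have "\<dots> = weighted_ip n w (q l) (p j)"
      using Npos[of l] less.prems by (simp add: c_def N)
    finally show ?case by simp
  qed
  define r where "r j = complex_of_real (sqrt (N j))" for j
  have r: "r j * r j = of_real (N j)" "cnj (r j) = r j" "r j \<noteq> 0" if "j < n" for j
    using Npos[OF that] by (auto simp: r_def of_real_mult[symmetric] simp del: of_real_mult)
  \<comment> \<open>Beyond \<open>n\<close> nothing is normalized: the expansion of
    \<open>p j\<close> is claimed for every \<open>j\<close>, but norms are known to be positive
    only below \<open>n\<close>.\<close>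
  define e where "e j i = (if j < n then q j i / r j else q j i)" for i j
  define C where "C l j = (if l = j then 1 else c l j) * (if l < n then r l else 1)" for l j
  have re: "(if j < n then r j else 1) * e j i = q j i" for i j
    using r(3) by (simp add: e_def)
  show ?thesis
  proof (rule exI[of _ e], rule exI[of _ C], intro conjI allI impI)
    fix j l assume jl: "j < n" "l < n"
    have "weighted_ip n w (e j) (e l) = weighted_ip n w (q j) (q l) / (r j * r l)"
      using jl r(2) by (simp add: weighted_ip_def e_def sum_divide_distrib)
    moreover have "weighted_ip n w (q j) (q l) = 0" if "j \<noteq> l"
      using orth[of j l] orth[of l j] jl that weighted_ip_cnj[of n w "q l" "q j"]
      by (cases "j < l") auto
    ultimately show "weighted_ip n w (e j) (e l) = (if j = l then 1 else 0)"
      using r jl Npos[of j] by (auto simp: N)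
  next
    fix i j :: nat
    have "{..j} = insert j {..<j}" by auto
    then have "(\<Sum>l\<le>j. C l j * e l i) = C j j * e j i + (\<Sum>l<j. C l j * e l i)" by simp
    also have "\<dots> = q j i + (\<Sum>l<j. c l j * q l i)"
      by (simp add: C_def mult.assoc re)
    finally show "p j i = (\<Sum>l\<le>j. C l j * e l i)" by (simp add: q[of j])
  qed (use r in \<open>auto simp: C_def\<close>)
qed

text \<open>Orthonormalizing a basis that triangularizes \<open>K\<close> changes it by an upper
  triangular matrix, so the matrix of \<open>K\<close> stays upper triangular with the same
  diagonal. \<open>dual\<close> supplies independence and \<open>dual'\<close> spanning.\<close>

lemma weighted_schur_form:
  fixes p Y B K :: "nat \<Rightarrow> nat \<Rightarrow> complex" and w :: "nat \<Rightarrow> real"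
  assumes w: "\<And>i. i < n \<Longrightarrow> 0 < w i"
    and dual: "\<And>j l. j < n \<Longrightarrow> l < n \<Longrightarrow> (\<Sum>i<n. Y j i * p l i) = (if j = l then 1 else 0)"
    and dual': "\<And>i m. i < n \<Longrightarrow> m < n \<Longrightarrow> (\<Sum>j<n. p j i * Y j m) = (if i = m then 1 else 0)"
    and tri: "\<And>j l. j < l \<Longrightarrow> l < n \<Longrightarrow> B l j = 0"
    and K: "\<And>i j. i < n \<Longrightarrow> j < n \<Longrightarrow> (\<Sum>m<n. K i m * p j m) = (\<Sum>l<n. B l j * p l i)"
  shows "\<exists>e T. (\<forall>j<n. \<forall>l<n. weighted_ip n w (e j) (e l) = (if j = l then 1 else 0))
    \<and> (\<forall>f. \<forall>i<n. f i = (\<Sum>l<n. weighted_ip n w (e l) f * e l i))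
    \<and> (\<forall>f. \<forall>l<n. weighted_ip n w (e l) (\<lambda>i. \<Sum>m<n. K i m * f m)
         = (\<Sum>j<n. T l j * weighted_ip n w (e j) f))
    \<and> (\<forall>j l. j < l \<longrightarrow> l < n \<longrightarrow> T l j = 0)
    \<and> (\<forall>j<n. T j j = B j j)"
proof -
  obtain e C where
    on: "\<And>j l. j < n \<Longrightarrow> l < n \<Longrightarrow> weighted_ip n w (e j) (e l) = (if j = l then 1 else 0)" and
    pC: "\<And>i j. p j i = (\<Sum>l\<le>j. C l j * e l i)" and
    C0: "\<And>j. j < n \<Longrightarrow> C j j \<noteq> 0"
    using orthonormal_flag[of n w Y p] w dual by blast
  define D where "D l j = (if l \<le> j then C l j else 0)" for l j
  have pD: "p j i = (\<Sum>l<n. D l j * e l i)" if "j < n" for i j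
  proof -
    have "(\<Sum>l<n. D l j * e l i) = (\<Sum>l\<le>j. D l j * e l i)"
      using that by (intro sum.mono_neutral_right) (auto simp: D_def)
    then show ?thesis by (simp add: pC D_def)
  qed
  have complete: "f i = (\<Sum>l<n. weighted_ip n w (e l) f * e l i)" if i: "i < n" for f i
  proof -
    define a where "a j = (\<Sum>m<n. Y j m * f m)" for j
    define b where "b l = (\<Sum>j<n. a j * D l j)" for l
    have fp: "f i = (\<Sum>j<n. a j * p j i)" if "i < n" for i
    proof -
      have "(\<Sum>j<n. a j * p j i) = (\<Sum>m<n. (\<Sum>j<n. p j i * Y j m) * f m)"
        unfolding a_def sum_distrib_right by (subst sum.swap) (simp add: mult_ac)
      also have "\<dots> = (\<Sum>m<n. if i = m then f m else 0)"
        using that by (intro sum.cong refl) (simp add: dual')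
      finally show ?thesis using that by (simp add: sum.delta)
    qed
    have fe: "f i = (\<Sum>l<n. b l * e l i)" if "i < n" for i
    proof -
      have "f i = (\<Sum>j<n. \<Sum>l<n. a j * D l j * e l i)"
        by (simp add: fp[OF that] pD sum_distrib_left mult.assoc)
      also have "\<dots> = (\<Sum>l<n. b l * e l i)"
        unfolding b_def sum_distrib_right by (rule sum.swap)
      finally show ?thesis .
    qed
    have "weighted_ip n w (e l) f = b l" if l: "l < n" for l
    proof -
      have "weighted_ip n w (e l) f = weighted_ip n w (e l) (\<lambda>i. \<Sum>m<n. b m * e m i)"
        by (intro weighted_ip_cong) (auto simp: fe)
      also have "\<dots> = (\<Sum>m<n. b m * (if l = m then 1 else 0))"
        unfolding weighted_ip_sum_right using l by (intro sum.cong refl) (simp add: on)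
      finally show ?thesis using l by (simp add: sum.delta if_distrib cong: if_cong)
    qed
    then show ?thesis using fe[OF i] by simp
  qed
  define T where "T l j = weighted_ip n w (e l) (\<lambda>i. \<Sum>m<n. K i m * e j m)" for l j
  have KT: "weighted_ip n w (e l) (\<lambda>i. \<Sum>m<n. K i m * f m)
      = (\<Sum>j<n. c j * T l j)"
    if f: "\<And>m. m < n \<Longrightarrow> f m = (\<Sum>j<n. c j * e j m)" for c f l
  proof -
    have "(\<Sum>m<n. K i m * f m) = (\<Sum>j<n. c j * (\<Sum>m<n. K i m * e j m))" for i
    proof -
      have "(\<Sum>m<n. K i m * f m) = (\<Sum>m<n. K i m * (\<Sum>j<n. c j * e j m))"
        by (intro sum.cong refl) (simp add: f)
      also have "\<dots> = (\<Sum>j<n. c j * (\<Sum>m<n. K i m * e j m))"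
        unfolding sum_distrib_left by (subst sum.swap) (simp add: mult_ac)
      finally show ?thesis .
    qed
    then show ?thesis by (simp add: weighted_ip_sum_right T_def)
  qed
  \<comment> \<open>This is the matrix identity T D = D B for the transition matrix
    \<open>D\<close>.\<close>
  have TD: "(\<Sum>l<n. D l j * T i l) = (\<Sum>l<n. B l j * D i l)" if ij: "i < n" "j < n" for i j
  proof -
    have "(\<Sum>l<n. D l j * T i l) = weighted_ip n w (e i) (\<lambda>i. \<Sum>m<n. K i m * p j m)"
      by (rule KT[symmetric]) (rule pD[OF ij(2)])
    also have "\<dots> = weighted_ip n w (e i) (\<lambda>k. \<Sum>l<n. B l j * p l k)"
      using ij by (intro weighted_ip_cong) (auto simp: K)
    also have "\<dots> = (\<Sum>l<n. B l j * weighted_ip n w (e i) (p l))"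
      by (rule weighted_ip_sum_right)
    also have "\<dots> = (\<Sum>l<n. B l j * D i l)"
    proof (intro sum.cong refl)
      fix l assume l: "l \<in> {..<n}"
      have "weighted_ip n w (e i) (p l) = weighted_ip n w (e i) (\<lambda>k. \<Sum>m<n. D m l * e m k)"
        using l by (intro weighted_ip_cong) (auto simp: pD)
      also have "\<dots> = (\<Sum>m<n. D m l * (if i = m then 1 else 0))"
        unfolding weighted_ip_sum_right using ij by (intro sum.cong refl) (simp add: on)
      finally show "B l j * weighted_ip n w (e i) (p l) = B l j * D i l"
        using ij by (simp add: sum.delta if_distrib cong: if_cong)
    qed
    finally show ?thesis .
  qed
  \<comment> \<open>Solved column by column, without inverting \<open>D\<close>. By induction only
    the term with \<open>D j j\<close> survives on the left; on the right, \<open>B l j\<close>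
    requires l \<le> j while \<open>D i l\<close> requires i \<le> l.\<close>
  have T0: "T i j = 0" if "j < i" "i < n" for i j
    using that
  proof (induction j rule: less_induct)
    case (less j)
    have "(\<Sum>l<n. D l j * T i l) = (\<Sum>l<n. if l = j then D j j * T i j else 0)"
      using less by (intro sum.cong refl) (auto simp: D_def)
    also have "\<dots> = D j j * T i j" using less.prems by (simp add: sum.delta)
    finally have "D j j * T i j = (\<Sum>l<n. B l j * D i l)" using TD less.prems by simp
    also have "\<dots> = 0"
    proof (intro sum.neutral ballI)
      fix l assume "l \<in> {..<n}"
      then show "B l j * D i l = 0" using tri[of j l] less.prems by (cases "j < l") (auto simp: D_def)
    qed
    finally show ?case using C0[of j] less.prems by (simp add: D_def)
  qed
  have Td: "T j j = B j j" if j: "j < n" for j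
  proof -
    have "(\<Sum>l<n. D l j * T j l) = (\<Sum>l<n. if l = j then D j j * T j j else 0)"
      using j T0[of _ j] by (intro sum.cong refl) (auto simp: D_def)
    also have "\<dots> = D j j * T j j" using j by (simp add: sum.delta)
    finally have "D j j * T j j = (\<Sum>l<n. B l j * D j l)" using TD j by simp
    also have "\<dots> = (\<Sum>l<n. if l = j then D j j * B j j else 0)"
      using tri[of j] by (intro sum.cong refl) (auto simp: D_def)
    also have "\<dots> = D j j * B j j" using j by (simp add: sum.delta)
    finally show ?thesis using C0[OF j] by (simp add: D_def)
  qed
  show ?thesis
  proof (rule exI[of _ e], rule exI[of _ T], intro conjI allI impI)
    show "weighted_ip n w (e l) (\<lambda>i. \<Sum>m<n. K i m * f m) = (\<Sum>j<n. T l j * weighted_ip n w (e j) f)"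
      for f l
      using KT[of f "\<lambda>j. weighted_ip n w (e j) f" l] complete by (simp add: mult.commute)
  qed (use on complete T0 Td in auto)
qed

section \<open>Decay of accretive triangular systems\<close>

text \<open>Origin of the ratio 3: subtracting (s k + s (k+1)) / 2 from s k - s (k+1) leaves s k / 2
  - 3 s (k+1) / 2, and the next partial sum compensates the negative term exactly when its weight is
  three times as large.\<close>

lemma geometric_telescope:
  fixes s d :: "nat \<Rightarrow> real"
  assumes "k \<le> n" and s: "\<And>j. 0 \<le> s j" "s n = 0"
    and d: "\<And>j. k \<le> j \<Longrightarrow> j < n \<Longrightarrow> d j \<le> 2 * (s j + s (Suc j))"
  shows "3 ^ k * s k / 2 \<le> (\<Sum>j=k..<n. 3 ^ j * ((s j - s (Suc j)) - d j / 4))"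
  using assms(1) d
proof (induction k rule: inc_induct)
  case base
  then show ?case using s by simp
next
  case (step k)
  have "3 ^ k * s k / 2 = 3 ^ k * (s k - s (Suc k) - (s k + s (Suc k)) / 2) + 3 ^ Suc k * s (Suc k) / 2"
    by (simp add: field_simps)
  also have "\<dots> \<le> 3 ^ k * (s k - s (Suc k) - d k / 4) + 3 ^ Suc k * s (Suc k) / 2"
    using step.prems[of k] step.hyps by (intro add_right_mono mult_left_mono) auto
  also have "\<dots> \<le> 3 ^ k * (s k - s (Suc k) - d k / 4)
      + (\<Sum>j=Suc k..<n. 3 ^ j * ((s j - s (Suc j)) - d j / 4))"
    using step by (intro add_left_mono step.IH) auto
  also have "\<dots> = (\<Sum>j=k..<n. 3 ^ j * ((s j - s (Suc j)) - d j / 4))"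
    using step.hyps by (simp add: sum.atLeast_Suc_lessThan)
  finally show ?case .
qed

text \<open>Back substitution from the last row: each equation reads (1 - T l l) c l = 0 once the
  later coordinates are gone. Row 0, where the eigenvalue 1 sits, is left out.\<close>

lemma upper_triangular_fixed_vector:
  fixes T :: "nat \<Rightarrow> nat \<Rightarrow> complex"
  assumes tri: "\<And>j l. j < l \<Longrightarrow> l < n \<Longrightarrow> T l j = 0"
    and diag: "\<And>j. 1 \<le> j \<Longrightarrow> j < n \<Longrightarrow> T j j \<noteq> 1"
    and fixed: "\<And>l. l < n \<Longrightarrow> c l = (\<Sum>j<n. T l j * c j)"
    and "1 \<le> l" "l < n"
  shows "c l = 0"
  using assms(4,5)
proof (induction "n - l" arbitrary: l rule: less_induct)
  case less
  have "c l = (\<Sum>j<n. if j = l then T l l * c l else 0)"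
    unfolding fixed[OF less.prems(2)]
  proof (intro sum.cong refl)
    fix j assume "j \<in> {..<n}"
    then show "T l j * c j = (if j = l then T l l * (\<Sum>j<n. T l j * c j) else 0)"
      using less.hyps[of j] less.prems tri[of j l] fixed[of l] by (cases j l rule: linorder_cases) auto
  qed
  also have "\<dots> = T l l * c l" using less.prems by (simp add: sum.delta)
  finally have "(1 - T l l) * c l = 0" by (simp add: left_diff_distrib)
  then show ?case using diag[OF less.prems] by simp
qed

definition re_form :: "nat \<Rightarrow> (nat \<Rightarrow> nat \<Rightarrow> complex) \<Rightarrow> (nat \<Rightarrow> complex) \<Rightarrow> real" where
  "re_form n L x = Re (\<Sum>l<n. cnj (x l) * (\<Sum>j<n. L l j * x j))"

lemma re_form_parallelogram:
  "re_form n L (\<lambda>i. x i - y i) + re_form n L (\<lambda>i. x i + y i) = 2 * re_form n L x + 2 * re_form n L y"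
proof -
  have eq: "re_form n L x = (\<Sum>l<n. \<Sum>j<n. Re (cnj (x l) * (L l j * x j)))" for x
    unfolding re_form_def by (simp add: sum_distrib_left)
  show ?thesis
    unfolding eq sum_distrib_left sum.distrib[symmetric]
  proof (intro sum.cong refl)
    fix l j
    have "cnj (x l - y l) * (L l j * (x j - y j)) + cnj (x l + y l) * (L l j * (x j + y j))
        = 2 * (cnj (x l) * (L l j * x j)) + 2 * (cnj (y l) * (L l j * y j))"
      by (simp add: algebra_simps)
    from arg_cong[OF this, of Re]
    show "Re (cnj (x l - y l) * (L l j * (x j - y j))) + Re (cnj (x l + y l) * (L l j * (x j + y j)))
        = 2 * Re (cnj (x l) * (L l j * x j)) + 2 * Re (cnj (y l) * (L l j * y j))"
      by simp
  qed
qed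

text \<open>
  With \<open>s\<^sub>k\<close> the form evaluated at the tail \<open>(x\<^sub>k, \<dots>)\<close>, the \<open>k\<close>-th summand without weight is
  \<open>s\<^sub>k - s\<^sub>k\<^sub>+\<^sub>1\<close>, and the parallelogram law bounds \<open>Re L\<^sub>k\<^sub>k |x\<^sub>k|\<^sup>2\<close> by \<open>2 (s\<^sub>k + s\<^sub>k\<^sub>+\<^sub>1)\<close>.
\<close>

lemma accretive_triangular_weighted:
  fixes L :: "nat \<Rightarrow> nat \<Rightarrow> complex" and x :: "nat \<Rightarrow> complex"
  assumes n: "1 \<le> n"
    and tri: "\<And>j l. j < l \<Longrightarrow> l < n \<Longrightarrow> L l j = 0"
    and acc: "\<And>x. 0 \<le> re_form n L x"
    and diag: "\<And>j. 1 \<le> j \<Longrightarrow> j < n \<Longrightarrow> \<gamma> \<le> Re (L j j)"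
  shows "\<gamma> / 4 * (\<Sum>j=1..<n. 3 ^ j * (cmod (x j))\<^sup>2)
    \<le> (\<Sum>j=1..<n. 3 ^ j * Re (cnj (x j) * (\<Sum>m<n. L j m * x m)))"
proof -
  define a where "a j = Re (cnj (x j) * (\<Sum>m<n. L j m * x m))" for j
  define tail where "tail k i = (if k \<le> i then x i else 0)" for k i
  define s where "s k = (\<Sum>j=k..<n. a j)" for k
  have s_form: "s k = re_form n L (tail k)" for k
  proof -
    have "re_form n L (tail k) = (\<Sum>l<n. if k \<le> l then a l else 0)"
      unfolding re_form_def Re_sum
    proof (intro sum.cong refl)
      fix l assume l: "l \<in> {..<n}"
      \<comment> \<open>Row \<open>l\<close> only sees coordinates from \<open>l\<close> on, so for
        l \<ge> k it does not notice the truncation.\<close>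
      have "(\<Sum>j<n. L l j * tail k j) = (\<Sum>j<n. L l j * x j)" if "k \<le> l"
        using that l tri[of _ l] by (intro sum.cong refl) (auto simp: tail_def)
      then show "Re (cnj (tail k l) * (\<Sum>j<n. L l j * tail k j)) = (if k \<le> l then a l else 0)"
        by (cases "k \<le> l") (simp_all add: a_def tail_def[of k l])
    qed
    also have "\<dots> = sum a {l\<in>{..<n}. k \<le> l}" by (intro sum.inter_filter[symmetric]) simp
    also have "{l\<in>{..<n}. k \<le> l} = {k..<n}" by auto
    finally show ?thesis by (simp add: s_def)
  qed
  have s0: "0 \<le> s k" for k by (simp add: s_form acc)
  have s_diff: "s j - s (Suc j) = a j" if "j < n" for j
    using that by (simp add: s_def sum.atLeast_Suc_lessThan)
  have d: "\<gamma> * (cmod (x j))\<^sup>2 \<le> 2 * (s j + s (Suc j))" if j: "1 \<le> j" "j < n" for j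
  proof -
    have single: "tail j i - tail (Suc j) i = (if i = j then x j else 0)" for i
      by (auto simp: tail_def)
    have "re_form n L (\<lambda>i. tail j i - tail (Suc j) i)
        = Re (\<Sum>l<n. cnj (if l = j then x j else 0) * (\<Sum>i<n. if i = j then L l j * x j else 0))"
      unfolding re_form_def single
      by (intro arg_cong[where f = Re] sum.cong refl arg_cong2[where f = "(*)"]) auto
    also have "\<dots> = Re (\<Sum>l<n. if l = j then cnj (x j) * (L j j * x j) else 0)"
      using j by (intro arg_cong[where f = Re] sum.cong refl) (auto simp: sum.delta)
    also have "\<dots> = Re (L j j * (x j * cnj (x j)))" using j by (simp add: sum.delta mult_ac)
    also have "\<dots> = Re (L j j) * (cmod (x j))\<^sup>2"
      by (simp add: complex_norm_square[symmetric] del: of_real_power)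
    finally have e: "re_form n L (\<lambda>i. tail j i - tail (Suc j) i) = Re (L j j) * (cmod (x j))\<^sup>2" .
    have "\<gamma> * (cmod (x j))\<^sup>2 \<le> Re (L j j) * (cmod (x j))\<^sup>2"
      using diag j by (intro mult_right_mono) auto
    also have "\<dots> \<le> 2 * (s j + s (Suc j))"
      using re_form_parallelogram[of n L "tail j" "tail (Suc j)", unfolded e]
        acc[of "\<lambda>i. tail j i + tail (Suc j) i"] unfolding s_form distrib_left by linarith
    finally show ?thesis .
  qed
  have "0 \<le> 3 ^ 1 * s 1 / 2" using s0[of 1] by simp
  also have "\<dots> \<le> (\<Sum>j=1..<n. 3 ^ j * ((s j - s (Suc j)) - \<gamma> * (cmod (x j))\<^sup>2 / 4))"
    using n s0 d by (intro geometric_telescope) (auto simp: s_def)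
  also have "\<dots> = (\<Sum>j=1..<n. 3 ^ j * a j - \<gamma> / 4 * (3 ^ j * (cmod (x j))\<^sup>2))"
    by (intro sum.cong refl) (simp add: s_diff algebra_simps)
  also have "\<dots> = (\<Sum>j=1..<n. 3 ^ j * a j) - \<gamma> / 4 * (\<Sum>j=1..<n. 3 ^ j * (cmod (x j))\<^sup>2)"
    by (simp add: sum_subtractf sum_distrib_left)
  finally show ?thesis by (simp add: a_def)
qed

text \<open>Coordinate 0 belongs to the eigenvalue 1 and vanishes on functions of mean zero, so the
  sum starts at 1.\<close>

definition lyapunov :: "nat \<Rightarrow> (nat \<Rightarrow> complex) \<Rightarrow> real" where
  "lyapunov n x = (\<Sum>j=1..<n. 3 ^ j * (cmod (x j))\<^sup>2)"

lemma lyapunov_nonneg: "0 \<le> lyapunov n x"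
  unfolding lyapunov_def by (intro sum_nonneg) simp

lemma lyapunov_ge:
  assumes "1 \<le> j" "j < n"
  shows "(cmod (x j))\<^sup>2 \<le> lyapunov n x"
proof -
  have "(cmod (x j))\<^sup>2 \<le> 3 ^ j * (cmod (x j))\<^sup>2"
    using mult_right_mono[of 1 "3 ^ j :: real" "(cmod (x j))\<^sup>2"] by simp
  also have "\<dots> \<le> lyapunov n x"
    unfolding lyapunov_def using assms by (intro member_le_sum) auto
  finally show ?thesis .
qed

text \<open>\<open>M\<close> is a crude constant; what matters is that it does not depend on \<eta>
  or \<open>x\<close>. Then k steps of size t / k accumulate an error of only t^2 M / k in the
  exponent, which disappears in the limit.\<close>

lemma lyapunov_euler_step:
  fixes L :: "nat \<Rightarrow> nat \<Rightarrow> complex"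
  assumes n: "1 \<le> n"
    and tri: "\<And>j l. j < l \<Longrightarrow> l < n \<Longrightarrow> L l j = 0"
    and acc: "\<And>x. 0 \<le> re_form n L x"
    and diag: "\<And>j. 1 \<le> j \<Longrightarrow> j < n \<Longrightarrow> \<gamma> \<le> Re (L j j)"
  shows "\<exists>M. \<forall>\<eta> x x'. 0 \<le> \<eta> \<longrightarrow> (\<forall>j<n. x' j = x j - of_real \<eta> * (\<Sum>m<n. L j m * x m))
    \<longrightarrow> lyapunov n x' \<le> exp (- (\<eta> * \<gamma> / 2) + \<eta>\<^sup>2 * M) * lyapunov n x"
proof -
  define c where "c j = (\<Sum>m<n. cmod (L j m))" for j
  define M where "M = (\<Sum>j=1..<n. 3 ^ j * (c j)\<^sup>2)"
  have "lyapunov n x' \<le> exp (- (\<eta> * \<gamma> / 2) + \<eta>\<^sup>2 * M) * lyapunov n x"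
    if \<eta>: "0 \<le> \<eta>" and x': "\<And>j. j < n \<Longrightarrow> x' j = x j - of_real \<eta> * (\<Sum>m<n. L j m * x m)"
    for \<eta> x x'
  proof -
    define b where "b j = (\<Sum>m<n. L j m * x m)" for j
    define V where "V = lyapunov n x"
    have V0: "0 \<le> V" by (simp add: V_def lyapunov_nonneg)
    have b: "(cmod (b j))\<^sup>2 \<le> (c j)\<^sup>2 * V" if j: "1 \<le> j" "j < n" for j
    proof -
      have "cmod (b j) \<le> (\<Sum>m<n. cmod (L j m * x m))" unfolding b_def by (rule norm_sum)
      also have "\<dots> \<le> (\<Sum>m<n. cmod (L j m) * sqrt V)"
      proof (intro sum_mono)
        fix m assume m: "m \<in> {..<n}"
        show "cmod (L j m * x m) \<le> cmod (L j m) * sqrt V"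
        proof (cases "m < j")
          \<comment> \<open>Row \<open>j\<close> \<ge> 1 has no entry in column \<open>m\<close> <
            \<open>j\<close>. In particular coordinate 0, which the Lyapunov function does not see,
            never enters.\<close>
          case True
          then show ?thesis using tri[of m j] j V0 by simp
        next
          case False
          then have "(cmod (x m))\<^sup>2 \<le> V"
            unfolding V_def using j m by (intro lyapunov_ge) auto
          then have "cmod (x m) \<le> sqrt V" by (rule real_le_rsqrt)
          then show ?thesis unfolding norm_mult by (intro mult_left_mono) auto
        qed
      qed
      also have "\<dots> = c j * sqrt V" by (simp add: c_def sum_distrib_right)
      finally have "(cmod (b j))\<^sup>2 \<le> (c j * sqrt V)\<^sup>2" by (intro power_mono) auto
      then show ?thesis using V0 by (simp add: power_mult_distrib)
    qed
    have norm_step: "(cmod (x j - of_real \<eta> * b j))\<^sup>2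
        = (cmod (x j))\<^sup>2 - 2 * \<eta> * Re (cnj (x j) * b j) + \<eta>\<^sup>2 * (cmod (b j))\<^sup>2" for j
      unfolding cmod_power2 by (simp add: power2_eq_square algebra_simps)
    have "lyapunov n x' = (\<Sum>j=1..<n. 3 ^ j * (cmod (x j))\<^sup>2
        - 2 * \<eta> * (3 ^ j * Re (cnj (x j) * b j)) + \<eta>\<^sup>2 * (3 ^ j * (cmod (b j))\<^sup>2))"
      unfolding lyapunov_def
    proof (intro sum.cong refl)
      fix j assume "j \<in> {1..<n}"
      then have "x' j = x j - of_real \<eta> * b j" by (simp add: x' b_def)
      then have eq: "(cmod (x' j))\<^sup>2
          = (cmod (x j))\<^sup>2 - 2 * \<eta> * Re (cnj (x j) * b j) + \<eta>\<^sup>2 * (cmod (b j))\<^sup>2"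
        using norm_step by simp
      show "3 ^ j * (cmod (x' j))\<^sup>2 = 3 ^ j * (cmod (x j))\<^sup>2
          - 2 * \<eta> * (3 ^ j * Re (cnj (x j) * b j)) + \<eta>\<^sup>2 * (3 ^ j * (cmod (b j))\<^sup>2)"
        unfolding eq by (simp only: algebra_simps)
    qed
    also have "\<dots> = V - 2 * \<eta> * (\<Sum>j=1..<n. 3 ^ j * Re (cnj (x j) * b j))
        + \<eta>\<^sup>2 * (\<Sum>j=1..<n. 3 ^ j * (cmod (b j))\<^sup>2)"
      by (simp add: V_def lyapunov_def sum.distrib sum_subtractf sum_distrib_left)
    also have "\<dots> \<le> V - 2 * \<eta> * (\<gamma> / 4 * V) + \<eta>\<^sup>2 * (M * V)"
    proof (intro add_mono diff_left_mono mult_left_mono)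
      show "\<gamma> / 4 * V \<le> (\<Sum>j=1..<n. 3 ^ j * Re (cnj (x j) * b j))"
        unfolding V_def lyapunov_def b_def
        by (rule accretive_triangular_weighted[OF n tri acc diag])
      have "(\<Sum>j=1..<n. 3 ^ j * (cmod (b j))\<^sup>2) \<le> (\<Sum>j=1..<n. 3 ^ j * ((c j)\<^sup>2 * V))"
        using b by (intro sum_mono mult_left_mono) auto
      then show "(\<Sum>j=1..<n. 3 ^ j * (cmod (b j))\<^sup>2) \<le> M * V"
        by (simp add: M_def sum_distrib_right mult.assoc)
    qed (use \<eta> in auto)
    also have "\<dots> = (1 + (- (\<eta> * \<gamma> / 2) + \<eta>\<^sup>2 * M)) * V" by (simp add: algebra_simps)
    also have "\<dots> \<le> exp (- (\<eta> * \<gamma> / 2) + \<eta>\<^sup>2 * M) * V"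
      by (intro mult_right_mono exp_ge_add_one_self V0)
    finally show ?thesis by (simp add: V_def)
  qed
  then show ?thesis by blast
qed

section \<open>Euler steps of the Markov operator: retention of mass and accretivity\<close>

context circulation
begin

definition step :: "real \<Rightarrow> (nat \<Rightarrow> real) \<Rightarrow> nat \<Rightarrow> real" where
  "step \<eta> f i = (1 - \<eta>) * f i + \<eta> * ((\<Sum>j<n. Q i j * f j) / \<pi> i)"

lemma \<pi>_step: "i < n \<Longrightarrow> \<pi> i * step \<eta> f i = (1 - \<eta>) * (\<pi> i * f i) + \<eta> * (\<Sum>j<n. Q i j * f j)"
  using \<pi>_pos[of i] by (simp add: step_def algebra_simps)

lemma mean_step: "(\<Sum>i<n. \<pi> i * step \<eta> f i) = (\<Sum>i<n. \<pi> i * f i)"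
proof -
  have "(\<Sum>i<n. \<pi> i * step \<eta> f i)
      = (1 - \<eta>) * (\<Sum>i<n. \<pi> i * f i) + \<eta> * (\<Sum>i<n. \<Sum>j<n. Q i j * f j)"
    by (simp add: \<pi>_step sum.distrib sum_distrib_left)
  then show ?thesis unfolding col_weighted by (simp add: algebra_simps)
qed

lemma step_bounds:
  assumes \<eta>: "0 \<le> \<eta>" "\<eta> \<le> 1" and f: "\<And>i. i < n \<Longrightarrow> 0 \<le> f i \<and> f i \<le> 1" and i: "i < n"
  shows "0 \<le> step \<eta> f i \<and> step \<eta> f i \<le> 1"
proof -
  have "0 \<le> (\<Sum>j<n. Q i j * f j)" using f Q_nonneg i by (intro sum_nonneg) simp
  then have lo: "0 \<le> (\<Sum>j<n. Q i j * f j) / \<pi> i" using \<pi>_pos[OF i] by simp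
  have "(\<Sum>j<n. Q i j * f j) \<le> (\<Sum>j<n. Q i j * 1)"
    using f Q_nonneg i by (intro sum_mono mult_left_mono) auto
  then have hi: "(\<Sum>j<n. Q i j * f j) / \<pi> i \<le> 1" using \<pi>_pos[OF i] row_sum[OF i] by simp
  have "step \<eta> f i \<le> (1 - \<eta>) * 1 + \<eta> * 1"
    unfolding step_def using \<eta> f[OF i] hi by (intro add_mono mult_left_mono) auto
  moreover have "0 \<le> step \<eta> f i"
    unfolding step_def using \<eta> f[OF i] lo by (intro add_nonneg_nonneg mult_nonneg_nonneg) auto
  ultimately show ?thesis by simp
qed

text \<open>Inflow equals outflow, since each completes the internal flow of \<open>S\<close> to its
  mass.\<close>

lemma flow_sym:
  assumes S: "S \<subseteq> {..<n}"
  shows "(\<Sum>j\<in>S. \<Sum>i\<in>{..<n} - S. Q i j) = flow S"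
proof -
  have split: "(\<Sum>j<n. a j) = (\<Sum>j\<in>S. a j) + (\<Sum>j\<in>{..<n} - S. a j)" for a :: "nat \<Rightarrow> real"
    using sum.subset_diff[OF S, of a] by simp
  have "(\<Sum>j\<in>S. \<Sum>i\<in>{..<n} - S. Q i j) + (\<Sum>j\<in>S. \<Sum>i\<in>S. Q i j) = (\<Sum>j\<in>S. \<pi> j)"
    unfolding sum.distrib[symmetric]
  proof (intro sum.cong refl)
    fix j assume "j \<in> S"
    then have "j < n" using S by auto
    then show "(\<Sum>i\<in>{..<n} - S. Q i j) + (\<Sum>i\<in>S. Q i j) = \<pi> j"
      using col_sum[of j] split[of "\<lambda>i. Q i j"] by linarith
  qed
  moreover have "flow S + (\<Sum>i\<in>S. \<Sum>j\<in>S. Q i j) = (\<Sum>j\<in>S. \<pi> j)"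
    unfolding flow_def sum.distrib[symmetric]
  proof (intro sum.cong refl)
    fix i assume "i \<in> S"
    then have "i < n" using S by auto
    then show "(\<Sum>j\<in>{..<n} - S. Q i j) + (\<Sum>j\<in>S. Q i j) = \<pi> i"
      using row_sum[of i] split[of "Q i"] by linarith
  qed
  ultimately show ?thesis using sum.swap[of Q S S] by simp
qed

text \<open>The bounds 0 and 1 are carried along in the induction because they limit the next loss:
  with values at most 1, one step moves at most \<eta> times the boundary flow out of
  \<open>S\<close>.\<close>

lemma retention:
  assumes S: "S \<subseteq> {..<n}" and \<eta>: "0 \<le> \<eta>" "\<eta> \<le> 1"
  shows "sum \<pi> S - real k * \<eta> * flow S \<le> (\<Sum>i\<in>S. \<pi> i * ((step \<eta> ^^ k) (\<lambda>i. of_bool (i \<in> S))) i)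
    \<and> (\<forall>i<n. 0 \<le> ((step \<eta> ^^ k) (\<lambda>i. of_bool (i \<in> S))) i \<and> ((step \<eta> ^^ k) (\<lambda>i. of_bool (i \<in> S))) i \<le> 1)"
proof (induction k)
  case 0
  show ?case by simp
next
  case (Suc k)
  define g where "g = (step \<eta> ^^ k) (\<lambda>i. of_bool (i \<in> S))"
  have g: "0 \<le> g i \<and> g i \<le> 1" if "i < n" for i using Suc that by (simp add: g_def)
  \<comment> \<open>\<open>step\<close> averages over heads of edges, so mass at \<open>j\<close>
    travels to the tails \<open>i\<close> of edges into \<open>j\<close>. What gets lost runs along
    edges entering \<open>S\<close>; hence the appeal to \<open>flow_sym\<close>.\<close>
  have "(\<Sum>i\<in>S. \<pi> i * g i) - flow S = (\<Sum>j\<in>S. (\<Sum>i<n. Q i j) * g j - (\<Sum>i\<in>{..<n} - S. Q i j))"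
    unfolding flow_sym[OF S, symmetric] sum_subtractf
    using S by (intro arg_cong2[where f = minus] sum.cong refl) (auto simp: col_sum)
  also have "\<dots> \<le> (\<Sum>j\<in>S. \<Sum>i\<in>S. Q i j * g j)"
  proof (intro sum_mono)
    fix j assume j: "j \<in> S"
    have "(\<Sum>i<n. Q i j) * g j = (\<Sum>i\<in>S. Q i j * g j) + (\<Sum>i\<in>{..<n} - S. Q i j * g j)"
      unfolding sum_distrib_right using sum.subset_diff[OF S, of "\<lambda>i. Q i j * g j"] by simp
    moreover have "(\<Sum>i\<in>{..<n} - S. Q i j * g j) \<le> (\<Sum>i\<in>{..<n} - S. Q i j * 1)"
      using g j S Q_nonneg by (intro sum_mono mult_left_mono) auto
    ultimately show "(\<Sum>i<n. Q i j) * g j - (\<Sum>i\<in>{..<n} - S. Q i j) \<le> (\<Sum>i\<in>S. Q i j * g j)"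
      by simp
  qed
  also have "\<dots> = (\<Sum>i\<in>S. \<Sum>j\<in>S. Q i j * g j)" by (rule sum.swap)
  also have "\<dots> \<le> (\<Sum>i\<in>S. \<Sum>j<n. Q i j * g j)"
    using S g Q_nonneg by (intro sum_mono sum_mono2) (auto intro: mult_nonneg_nonneg)
  finally have "\<eta> * ((\<Sum>i\<in>S. \<pi> i * g i) - flow S) \<le> \<eta> * (\<Sum>i\<in>S. \<Sum>j<n. Q i j * g j)"
    using \<eta> by (intro mult_left_mono)
  then have "(\<Sum>i\<in>S. \<pi> i * g i) - \<eta> * flow S
      \<le> (1 - \<eta>) * (\<Sum>i\<in>S. \<pi> i * g i) + \<eta> * (\<Sum>i\<in>S. \<Sum>j<n. Q i j * g j)"
    by (simp add: algebra_simps)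
  also have "\<dots> = (\<Sum>i\<in>S. (1 - \<eta>) * (\<pi> i * g i) + \<eta> * (\<Sum>j<n. Q i j * g j))"
    by (simp add: sum.distrib sum_distrib_left)
  also have "\<dots> = (\<Sum>i\<in>S. \<pi> i * step \<eta> g i)"
    using S by (intro sum.cong refl) (auto simp: \<pi>_step)
  finally have "(\<Sum>i\<in>S. \<pi> i * g i) - \<eta> * flow S \<le> (\<Sum>i\<in>S. \<pi> i * step \<eta> g i)" .
  moreover have "sum \<pi> S - real k * \<eta> * flow S \<le> (\<Sum>i\<in>S. \<pi> i * g i)"
    using Suc by (simp add: g_def)
  ultimately have "sum \<pi> S - real (Suc k) * \<eta> * flow S \<le> (\<Sum>i\<in>S. \<pi> i * step \<eta> g i)"
    by (simp add: algebra_simps)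
  then show ?case using step_bounds[OF \<eta> g] by (simp add: g_def)
qed

text \<open>\<open>Q\<close> is real, so real and imaginary parts of \<open>f\<close> decouple, and
  for each of them the claim is nonnegativity of the Dirichlet form.\<close>

lemma re_form_markov:
  fixes f :: "nat \<Rightarrow> complex"
  shows "Re (weighted_ip n \<pi> f (\<lambda>i. \<Sum>m<n. of_real (Q i m / \<pi> i) * f m))
    \<le> (\<Sum>i<n. \<pi> i * (cmod (f i))\<^sup>2)"
proof -
  have eq: "weighted_ip n \<pi> f (\<lambda>i. \<Sum>m<n. of_real (Q i m / \<pi> i) * f m)
      = (\<Sum>i<n. \<Sum>m<n. of_real (Q i m) * (cnj (f i) * f m))"
    unfolding weighted_ip_def sum_distrib_left
  proof (intro sum.cong refl)
    fix i m assume "i \<in> {..<n}"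
    then have "\<pi> i \<noteq> 0" using \<pi>_pos[of i] by auto
    then show "of_real (\<pi> i) * cnj (f i) * (of_real (Q i m / \<pi> i) * f m)
        = of_real (Q i m) * (cnj (f i) * f m)"
      by simp
  qed
  have "Re (weighted_ip n \<pi> f (\<lambda>i. \<Sum>m<n. of_real (Q i m / \<pi> i) * f m))
    = (\<Sum>i<n. \<Sum>m<n. Q i m * Re (f i) * Re (f m)) + (\<Sum>i<n. \<Sum>m<n. Q i m * Im (f i) * Im (f m))"
    unfolding eq sum.distrib[symmetric] Re_sum
    by (intro sum.cong refl) (simp add: distrib_left mult.assoc)
  also have "\<dots> \<le> (\<Sum>i<n. \<pi> i * (Re (f i))\<^sup>2) + (\<Sum>i<n. \<pi> i * (Im (f i))\<^sup>2)"
    using dirichlet_nonneg[of "\<lambda>i. Re (f i)"] dirichlet_nonneg[of "\<lambda>i. Im (f i)"]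
    unfolding dirichlet_eq by (intro add_mono) simp_all
  also have "\<dots> = (\<Sum>i<n. \<pi> i * (cmod (f i))\<^sup>2)"
    unfolding sum.distrib[symmetric]
    by (intro sum.cong refl) (simp add: cmod_power2 distrib_left)
  finally show ?thesis .
qed

end

section \<open>Lower bound on the expansion\<close>

context circulation
begin

text \<open>The centred indicator of \<open>S\<close> is correlated with its own evolution up to
  time t. Retention keeps the correlation above m - m^2 - t flow(S), contraction brings it down to
  half of m - m^2, and the flow has to cover the difference.\<close>

lemma expansion_lower_bound:
  fixes p Y B :: "nat \<Rightarrow> nat \<Rightarrow> complex"
  assumes dual: "\<And>j l. j < n \<Longrightarrow> l < n \<Longrightarrow> (\<Sum>i<n. Y j i * p l i) = (if j = l then 1 else 0)"
    and dual': "\<And>i m. i < n \<Longrightarrow> m < n \<Longrightarrow> (\<Sum>j<n. p j i * Y j m) = (if i = m then 1 else 0)"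
    and tri: "\<And>j l. j < l \<Longrightarrow> l < n \<Longrightarrow> B l j = 0"
    and K: "\<And>i j. i < n \<Longrightarrow> j < n \<Longrightarrow>
      (\<Sum>m<n. complex_of_real (Q i m / \<pi> i) * p j m) = (\<Sum>l<n. B l j * p l i)"
    and gap: "\<And>j. 1 \<le> j \<Longrightarrow> j < n \<Longrightarrow> Re (B j j) \<le> 1 - \<gamma>" and \<gamma>: "0 < \<gamma>"
    and S: "S \<noteq> {}" "S \<subseteq> {..<n}" "sum \<pi> S \<le> 1 / 2"
  shows "\<gamma> / (28 * real n) * sum \<pi> S \<le> flow S"
proof -
  have n: "1 \<le> n" using S by auto
  define P where "P i m = complex_of_real (Q i m / \<pi> i)" for i m
  obtain e T where
    on: "\<forall>j<n. \<forall>l<n. weighted_ip n \<pi> (e j) (e l) = (if j = l then 1 else 0)" and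
    complete: "\<forall>f. \<forall>i<n. f i = (\<Sum>l<n. weighted_ip n \<pi> (e l) f * e l i)" and
    eT: "\<forall>f. \<forall>l<n. weighted_ip n \<pi> (e l) (\<lambda>i. \<Sum>m<n. P i m * f m)
         = (\<Sum>j<n. T l j * weighted_ip n \<pi> (e j) f)" and
    Ttri: "\<forall>j l. j < l \<longrightarrow> l < n \<longrightarrow> T l j = 0" and
    Tdiag: "\<forall>j<n. T j j = B j j"
    using weighted_schur_form[of n \<pi> Y p B P] \<pi>_pos dual dual' tri K unfolding P_def by blast
  define X where "X f l = weighted_ip n \<pi> (e l) f" for f l
  have parseval: "weighted_ip n \<pi> f g = (\<Sum>l<n. cnj (X f l) * X g l)" for f g
  proof -
    have "weighted_ip n \<pi> f g = weighted_ip n \<pi> f (\<lambda>i. \<Sum>l<n. X g l * e l i)"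
      unfolding X_def using complete by (intro weighted_ip_cong) auto
    then show ?thesis
      unfolding weighted_ip_sum_right by (simp add: X_def weighted_ip_cnj mult.commute)
  qed
  have parseval_self: "(\<Sum>i<n. \<pi> i * (cmod (f i))\<^sup>2) = (\<Sum>l<n. (cmod (X f l))\<^sup>2)" for f
  proof -
    have "complex_of_real (\<Sum>i<n. \<pi> i * (cmod (f i))\<^sup>2) = (\<Sum>l<n. cnj (X f l) * X f l)"
      unfolding weighted_ip_self[symmetric] by (rule parseval)
    also have "\<dots> = of_real (\<Sum>l<n. (cmod (X f l))\<^sup>2)"
      unfolding of_real_sum
      by (intro sum.cong refl) (simp add: complex_norm_square mult.commute del: of_real_power)
    finally show ?thesis by (simp only: of_real_eq_iff)
  qed
  define L where "L l j = (if l = j then 1 else 0) - T l j" for l j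
  have Lx: "(\<Sum>j<n. L l j * x j) = x l - (\<Sum>j<n. T l j * x j)" if "l < n" for l x
  proof -
    have "(\<Sum>j<n. L l j * x j) = (\<Sum>j<n. (if l = j then x j else 0) - T l j * x j)"
      by (intro sum.cong refl) (simp add: L_def left_diff_distrib)
    then show ?thesis using that by (simp add: sum_subtractf sum.delta)
  qed
  have acc: "0 \<le> re_form n L x" for x
  proof -
    define f where "f i = (\<Sum>l<n. x l * e l i)" for i
    have Xf: "X f l = x l" if "l < n" for l
    proof -
      have "X f l = (\<Sum>m<n. x m * (if l = m then 1 else 0))"
        unfolding X_def f_def weighted_ip_sum_right using that on by (intro sum.cong refl) simp
      then show ?thesis using that by (simp add: sum.delta if_distrib cong: if_cong)
    qed
    have "(\<Sum>l<n. cnj (x l) * (\<Sum>j<n. L l j * x j))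
        = (\<Sum>l<n. cnj (X f l) * X f l - cnj (X f l) * X (\<lambda>i. \<Sum>m<n. P i m * f m) l)"
    proof (intro sum.cong refl)
      fix l assume l: "l \<in> {..<n}"
      have "X (\<lambda>i. \<Sum>m<n. P i m * f m) l = (\<Sum>j<n. T l j * X f j)"
        using eT l by (simp add: X_def)
      also have "\<dots> = (\<Sum>j<n. T l j * x j)" by (intro sum.cong refl) (simp add: Xf)
      finally show "cnj (x l) * (\<Sum>j<n. L l j * x j)
          = cnj (X f l) * X f l - cnj (X f l) * X (\<lambda>i. \<Sum>m<n. P i m * f m) l"
        using l by (simp add: Lx Xf right_diff_distrib)
    qed
    also have "\<dots> = weighted_ip n \<pi> f f - weighted_ip n \<pi> f (\<lambda>i. \<Sum>m<n. P i m * f m)"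
      by (simp add: sum_subtractf parseval)
    finally have "re_form n L x = (\<Sum>i<n. \<pi> i * (cmod (f i))\<^sup>2)
        - Re (weighted_ip n \<pi> f (\<lambda>i. \<Sum>m<n. P i m * f m))"
      unfolding re_form_def by (simp only: weighted_ip_self minus_complex.sel Re_complex_of_real)
    then show ?thesis using re_form_markov[of f] unfolding P_def by linarith
  qed
  have Ltri: "L l j = 0" if "j < l" "l < n" for l j using Ttri that by (simp add: L_def)
  have Ldiag: "\<gamma> \<le> Re (L j j)" if "1 \<le> j" "j < n" for j
    using gap[OF that] Tdiag that by (simp add: L_def)
  obtain M where M: "\<forall>\<eta> x x'. 0 \<le> \<eta> \<longrightarrow> (\<forall>j<n. x' j = x j - of_real \<eta> * (\<Sum>m<n. L j m * x m))
    \<longrightarrow> lyapunov n x' \<le> exp (- (\<eta> * \<gamma> / 2) + \<eta>\<^sup>2 * M) * lyapunov n x"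
    using lyapunov_euler_step[of n L \<gamma>] n Ltri acc Ldiag by blast
  \<comment> \<open>Constants are fixed by \<open>P\<close>, so back substitution confines them to
    coordinate 0. Mean zero, being orthogonality to constants, then says that coordinate 0
    vanishes.\<close>
  define c where "c = X (\<lambda>_. 1)"
  have c_fixed: "c l = (\<Sum>j<n. T l j * c j)" if l: "l < n" for l
  proof -
    have "c l = X (\<lambda>i. \<Sum>m<n. P i m * 1) l"
      unfolding c_def X_def
    proof (intro weighted_ip_cong refl)
      fix i assume i: "i < n"
      have "(\<Sum>m<n. P i m * 1) = complex_of_real ((\<Sum>m<n. Q i m) / \<pi> i)"
        by (simp add: P_def sum_divide_distrib)
      then show "1 = (\<Sum>m<n. P i m * 1)" using row_sum[OF i] \<pi>_pos[OF i] by simp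
    qed
    also have "\<dots> = (\<Sum>j<n. T l j * c j)"
      unfolding X_def c_def using spec[OF eT, of "\<lambda>_. 1"] l by blast
    finally show ?thesis .
  qed
  have T1: "T j j \<noteq> 1" if "1 \<le> j" "j < n" for j
    using gap[OF that] Tdiag that \<gamma> by auto
  have c0: "c l = 0" if "1 \<le> l" "l < n" for l
  proof (rule upper_triangular_fixed_vector[of n T c, OF _ T1 c_fixed that])
    show "T l j = 0" if "j < l" "l < n" for j l using Ttri that by blast
  qed
  have split0: "(\<Sum>l<n. a l) = a 0 + (\<Sum>l=1..<n. a l)" for a :: "nat \<Rightarrow> 'a::comm_monoid_add"
    using n by (simp add: lessThan_atLeast0 sum.atLeast_Suc_lessThan)
  have c00: "c 0 \<noteq> 0"
  proof
    assume "c 0 = 0"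
    then have "(\<Sum>l<n. (cmod (c l))\<^sup>2) = 0" using c0 by (auto simp: split0)
    then show False using parseval_self[of "\<lambda>_. 1"] \<pi>_total by (simp add: c_def)
  qed
  have X0: "X (\<lambda>i. of_real (f i)) 0 = 0" if "(\<Sum>i<n. \<pi> i * f i) = 0" for f
  proof -
    have "weighted_ip n \<pi> (\<lambda>_. 1) (\<lambda>i. of_real (f i)) = of_real (\<Sum>i<n. \<pi> i * f i)"
      by (simp add: weighted_ip_def)
    then have "(\<Sum>l<n. cnj (c l) * X (\<lambda>i. of_real (f i)) l) = 0"
      using that by (simp add: parseval c_def)
    then show ?thesis using c0 c00 by (simp add: split0)
  qed
  define m where "m = sum \<pi> S"
  have m: "0 < m" "m \<le> 1 / 2" using mass_pos S by (auto simp: m_def)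
  \<comment> \<open>With this t, 3^n exp (- t \<gamma> / 2) is the n-th power of 3 exp (- 7/2) \<le>
    exp (- 3/2), hence at most exp (- 3) < 1/4 for n \<ge> 2. Its square root is the contraction by
    2.\<close>
  define t where "t = 7 * real n / \<gamma>"
  have t: "0 < t" using n \<gamma> by (simp add: t_def)
  \<comment> \<open>k \<ge> t keeps the step size at most 1, so that every step is a convex
    combination. The term with \<open>M\<close> is the discretization error.\<close>
  have main: "m - m\<^sup>2 - t * flow S \<le> (m - m\<^sup>2) * sqrt (3 ^ n * exp (- (t * \<gamma> / 2) + t\<^sup>2 * M / real k))"
    if k: "0 < k" "t \<le> real k" for k
  proof -
    define \<eta> where "\<eta> = t / real k"
    have \<eta>: "0 \<le> \<eta>" "\<eta> \<le> 1" using t k by (auto simp: \<eta>_def)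
    define g where "g j = (step \<eta> ^^ j) (\<lambda>i. of_bool (i \<in> S))" for j
    define f where "f j i = g j i - m" for j i
    define x where "x j = X (\<lambda>i. of_real (f j i))" for j
    have g_Suc: "g (Suc j) = step \<eta> (g j)" for j by (simp add: g_def)
    have inS: "(\<Sum>i<n. \<pi> i * (of_bool (i \<in> S) * h i)) = (\<Sum>i\<in>S. \<pi> i * h i)" for h :: "nat \<Rightarrow> real"
    proof -
      have "(\<Sum>i\<in>S. \<pi> i * h i) = (\<Sum>i\<in>S. \<pi> i * (of_bool (i \<in> S) * h i))"
        by (intro sum.cong refl) simp
      also have "\<dots> = (\<Sum>i<n. \<pi> i * (of_bool (i \<in> S) * h i))"
        using S by (intro sum.mono_neutral_left) auto
      finally show ?thesis by simp
    qed
    have mean_g: "(\<Sum>i<n. \<pi> i * g j i) = m" for j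
    proof (induction j)
      case 0
      show ?case using inS[of "\<lambda>_. 1"] by (simp add: g_def m_def)
    qed (simp add: g_Suc mean_step)
    have mean_f: "(\<Sum>i<n. \<pi> i * f j i) = 0" for j
      using mean_g[of j] \<pi>_total
      by (simp add: f_def right_diff_distrib sum_subtractf sum_distrib_right[symmetric])
    have x_Suc: "x (Suc j) l = x j l - of_real \<eta> * (\<Sum>i<n. L l i * x j i)" if l: "l < n" for j l
    proof -
      have f_Suc: "complex_of_real (f (Suc j) i)
          = of_real (f j i) - of_real \<eta> * (of_real (f j i) - (\<Sum>q<n. P i q * of_real (f j q)))"
        if i: "i < n" for i
      proof -
        have "(\<Sum>q<n. Q i q * f j q) = (\<Sum>q<n. Q i q * g j q) - \<pi> i * m"
          using row_sum[OF i]
          by (simp add: f_def right_diff_distrib sum_subtractf sum_distrib_right[symmetric])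
        then have "(\<Sum>q<n. Q i q * f j q) / \<pi> i = (\<Sum>q<n. Q i q * g j q) / \<pi> i - m"
          using \<pi>_pos[OF i] by (simp add: diff_divide_distrib)
        moreover have "f (Suc j) i = (1 - \<eta>) * g j i + \<eta> * ((\<Sum>q<n. Q i q * g j q) / \<pi> i) - m"
          by (simp add: f_def g_Suc step_def)
        ultimately have "f (Suc j) i = (1 - \<eta>) * (f j i + m) + \<eta> * ((\<Sum>q<n. Q i q * f j q) / \<pi> i + m) - m"
          by (simp add: f_def)
        then have "f (Suc j) i = f j i - \<eta> * (f j i - (\<Sum>q<n. Q i q * f j q) / \<pi> i)"
          by (simp add: algebra_simps)
        moreover have "(\<Sum>q<n. P i q * of_real (f j q)) = complex_of_real ((\<Sum>q<n. Q i q * f j q) / \<pi> i)"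
          by (simp add: P_def sum_divide_distrib)
        ultimately show ?thesis by simp
      qed
      have "x (Suc j) l = X (\<lambda>i. of_real (f j i)
          - of_real \<eta> * (of_real (f j i) - (\<Sum>q<n. P i q * of_real (f j q)))) l"
        unfolding x_def X_def by (intro weighted_ip_cong f_Suc refl)
      also have "\<dots> = x j l - of_real \<eta> * (x j l - X (\<lambda>i. \<Sum>q<n. P i q * of_real (f j q)) l)"
        unfolding x_def X_def weighted_ip_def
        by (simp add: right_diff_distrib sum_subtractf sum_distrib_left mult_ac)
      also have "X (\<lambda>i. \<Sum>q<n. P i q * of_real (f j q)) l = (\<Sum>i<n. T l i * x j i)"
        using eT l by (simp add: X_def x_def)
      finally show ?thesis using l by (simp add: Lx)
    qed
    define E where "E = exp (- (\<eta> * \<gamma> / 2) + \<eta>\<^sup>2 * M)"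
    have V: "lyapunov n (x j) \<le> E ^ j * lyapunov n (x 0)" for j
    proof (induction j)
      case (Suc j)
      have "lyapunov n (x (Suc j)) \<le> E * lyapunov n (x j)"
        unfolding E_def using M \<eta> x_Suc by blast
      also have "\<dots> \<le> E * (E ^ j * lyapunov n (x 0))"
        using Suc by (intro mult_left_mono) (simp_all add: E_def)
      finally show ?case by (simp add: mult.assoc)
    qed simp
    have norm_f: "(\<Sum>i<n. \<pi> i * (f j i)\<^sup>2) = (\<Sum>l=1..<n. (cmod (x j l))\<^sup>2)" for j
      using parseval_self[of "\<lambda>i. of_real (f j i)"] X0[OF mean_f[of j]]
      by (simp add: x_def split0)
    have le_V: "(\<Sum>i<n. \<pi> i * (f j i)\<^sup>2) \<le> lyapunov n (x j)" for j
      unfolding norm_f lyapunov_def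
    proof (intro sum_mono)
      fix l
      show "(cmod (x j l))\<^sup>2 \<le> 3 ^ l * (cmod (x j l))\<^sup>2"
        using mult_right_mono[of 1 "3 ^ l :: real" "(cmod (x j l))\<^sup>2"] by simp
    qed
    have V_le: "lyapunov n (x 0) \<le> 3 ^ n * (\<Sum>i<n. \<pi> i * (f 0 i)\<^sup>2)"
      unfolding norm_f lyapunov_def sum_distrib_left
      by (intro sum_mono mult_right_mono power_increasing) auto
    have norm_f0: "(\<Sum>i<n. \<pi> i * (f 0 i)\<^sup>2) = m - m\<^sup>2"
    proof -
      have "(\<Sum>i<n. \<pi> i * (f 0 i)\<^sup>2)
          = (\<Sum>i<n. \<pi> i * g 0 i - 2 * m * (\<pi> i * g 0 i) + \<pi> i * m\<^sup>2)"
        by (intro sum.cong refl) (auto simp: f_def g_def power2_eq_square algebra_simps)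
      also have "\<dots> = m - 2 * m * m + m\<^sup>2"
        using mean_g[of 0] \<pi>_total
        by (simp add: sum.distrib sum_subtractf sum_distrib_left[symmetric] sum_distrib_right[symmetric])
      finally show ?thesis by (simp add: power2_eq_square)
    qed
    have "(\<Sum>i<n. \<pi> i * f 0 i * f k i) = (\<Sum>i<n. \<pi> i * (of_bool (i \<in> S) * g k i)) - m * (\<Sum>i<n. \<pi> i * g k i)
        - m * (\<Sum>i<n. \<pi> i * f 0 i)"
      unfolding sum_distrib_left sum_subtractf[symmetric]
      by (intro sum.cong refl) (simp add: f_def g_def algebra_simps)
    also have "\<dots> = (\<Sum>i\<in>S. \<pi> i * g k i) - m\<^sup>2"
      by (simp add: inS mean_g mean_f power2_eq_square)
    also have "\<dots> \<ge> m - real k * \<eta> * flow S - m\<^sup>2"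
      using retention[OF S(2) \<eta>, of k] by (simp add: g_def m_def)
    finally have lower: "m - m\<^sup>2 - t * flow S \<le> (\<Sum>i<n. \<pi> i * f 0 i * f k i)"
      using k by (simp add: \<eta>_def)
    have mm: "0 \<le> m - m\<^sup>2" using norm_f0 \<pi>_pos by (metis (no_types, lifting) lessThan_iff less_imp_le
          mult_nonneg_nonneg sum_nonneg zero_le_power2)
    have "(\<Sum>i<n. \<pi> i * f 0 i * f k i)\<^sup>2 \<le> (m - m\<^sup>2) * (\<Sum>i<n. \<pi> i * (f k i)\<^sup>2)"
      using weighted_Cauchy_Schwarz[of "{..<n}" \<pi> "f 0" "f k"] \<pi>_pos
      by (simp add: norm_f0 less_imp_le)
    also have "\<dots> \<le> (m - m\<^sup>2) * (E ^ k * (3 ^ n * (m - m\<^sup>2)))"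
    proof (rule mult_left_mono[OF _ mm])
      have "E ^ k * lyapunov n (x 0) \<le> E ^ k * (3 ^ n * (m - m\<^sup>2))"
        using V_le norm_f0 by (intro mult_left_mono) (simp_all add: E_def)
      then show "(\<Sum>i<n. \<pi> i * (f k i)\<^sup>2) \<le> E ^ k * (3 ^ n * (m - m\<^sup>2))"
        using le_V[of k] V[of k] by linarith
    qed
    also have "\<dots> = (m - m\<^sup>2)\<^sup>2 * (3 ^ n * E ^ k)" by (simp add: power2_eq_square)
    also have "E ^ k = exp (- (t * \<gamma> / 2) + t\<^sup>2 * M / real k)"
    proof -
      have "E ^ k = exp (real k * (- (\<eta> * \<gamma> / 2) + \<eta>\<^sup>2 * M))"
        unfolding E_def by (rule exp_of_nat_mult[symmetric])
      also have "real k * (- (\<eta> * \<gamma> / 2) + \<eta>\<^sup>2 * M) = - (t * \<gamma> / 2) + t\<^sup>2 * M / real k"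
        using k by (simp add: \<eta>_def power2_eq_square field_simps)
      finally show ?thesis .
    qed
    finally have "(\<Sum>i<n. \<pi> i * f 0 i * f k i)
        \<le> sqrt ((m - m\<^sup>2)\<^sup>2 * (3 ^ n * exp (- (t * \<gamma> / 2) + t\<^sup>2 * M / real k)))"
      by (rule real_le_rsqrt)
    also have "\<dots> = (m - m\<^sup>2) * sqrt (3 ^ n * exp (- (t * \<gamma> / 2) + t\<^sup>2 * M / real k))"
      using mm by (simp add: real_sqrt_mult)
    finally show ?thesis using lower by linarith
  qed
  have lim: "(\<lambda>k. (m - m\<^sup>2) * sqrt (3 ^ n * exp (- (t * \<gamma> / 2) + t\<^sup>2 * M / real k)))
      \<longlonglongrightarrow> (m - m\<^sup>2) * sqrt (3 ^ n * exp (- (t * \<gamma> / 2) + 0))"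
    by (intro tendsto_intros lim_const_over_n)
  have "m - m\<^sup>2 - t * flow S \<le> (m - m\<^sup>2) * sqrt (3 ^ n * exp (- (t * \<gamma> / 2) + 0))"
  proof (rule LIMSEQ_le_const[OF lim], rule exI[of _ "max 1 (nat \<lceil>t\<rceil>)"], intro allI impI)
    fix k assume "max 1 (nat \<lceil>t\<rceil>) \<le> k"
    then have "0 < k" "t \<le> real k" by linarith+
    then show "m - m\<^sup>2 - t * flow S
        \<le> (m - m\<^sup>2) * sqrt (3 ^ n * exp (- (t * \<gamma> / 2) + t\<^sup>2 * M / real k))"
      by (rule main)
  qed
  also have "sqrt (3 ^ n * exp (- (t * \<gamma> / 2) + 0)) \<le> 1 / 2"
  proof -
    \<comment> \<open>For n = 1 the only nonempty set has mass 1, which exceeds 1/2.\<close>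
    have n2: "2 \<le> n"
    proof (rule ccontr)
      assume "\<not> ?thesis"
      then have "n = 1" using n by simp
      then show False using S \<pi>_total by (auto simp: subset_singleton_iff lessThan_Suc)
    qed
    have e3: "3 * exp (- (7 / 2)) \<le> exp (- (3 / 2) :: real)"
    proof -
      have "3 \<le> exp (2::real)" using exp_ge_add_one_self[of 2] by simp
      then have "3 * exp (- (7 / 2)) \<le> exp 2 * exp (- (7 / 2) :: real)" by simp
      also have "\<dots> = exp (- (3 / 2))" by (simp add: exp_add[symmetric])
      finally show ?thesis .
    qed
    have "3 ^ n * exp (- (t * \<gamma> / 2) + 0) = (3 * exp (- (7 / 2))) ^ n"
      using \<gamma> by (simp add: t_def power_mult_distrib exp_of_nat_mult[symmetric] mult.commute)
    also have "\<dots> \<le> exp (- (3 / 2)) ^ n" using e3 by (intro power_mono) auto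
    also have "\<dots> \<le> exp (- (3 / 2)) ^ 2" using n2 by (intro power_decreasing) auto
    also have "\<dots> = exp (- 3 :: real)"
      unfolding power2_eq_square exp_add[symmetric] by simp
    also have "\<dots> = 1 / exp (3::real)" by (simp add: exp_minus inverse_eq_divide)
    also have "\<dots> \<le> 1 / 4" using exp_ge_add_one_self[of 3] by (intro divide_left_mono) auto
    also have "\<dots> = (1 / 2)\<^sup>2" by (simp add: power2_eq_square)
    finally show ?thesis by (intro real_le_lsqrt) auto
  qed
  then have "(m - m\<^sup>2) * sqrt (3 ^ n * exp (- (t * \<gamma> / 2) + 0)) \<le> (m - m\<^sup>2) * (1 / 2)"
    using m by (intro mult_left_mono) (auto simp: power2_eq_square)
  finally have tf: "(m - m\<^sup>2) / 2 \<le> t * flow S" by simp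
  \<comment> \<open>A set of mass at most 1/2 has m - m^2 \<ge> m / 2, which gives m / 4 \<le> t
    flow(S); the constant 28 is 4 times 7.\<close>
  have "m * m \<le> m * (1 / 2)" using m by (intro mult_left_mono) auto
  then have "m / 4 \<le> t * flow S" using tf by (simp add: power2_eq_square)
  then show ?thesis using n \<gamma> by (simp add: t_def m_def field_simps)
qed

end

section \<open>Schur bases of real matrices\<close>

text \<open>The spans of \<open>p 0\<close>, ..., \<open>p j\<close> are invariant. The diagonal
  follows the order of \<open>ls\<close>, so that index 0 carries the PF eigenvalue and index 1 the
  eigenvalue \<lambda>_2. \<open>Y\<close> is the inverse of the basis matrix.\<close>

locale schur_data =
  fixes n :: nat and r :: "nat \<Rightarrow> nat \<Rightarrow> real" and ls :: "complex list"
    and p B Y :: "nat \<Rightarrow> nat \<Rightarrow> complex"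
  assumes dual: "\<And>j l. j < n \<Longrightarrow> l < n \<Longrightarrow> (\<Sum>i<n. Y j i * p l i) = (if j = l then 1 else 0)"
    and dual': "\<And>i m. i < n \<Longrightarrow> m < n \<Longrightarrow> (\<Sum>j<n. p j i * Y j m) = (if i = m then 1 else 0)"
    and tri: "\<And>j l. j < l \<Longrightarrow> l < n \<Longrightarrow> B l j = 0"
    and diag: "\<And>j. j < n \<Longrightarrow> B j j = ls ! j"
    and triangular: "\<And>i j. i < n \<Longrightarrow> j < n \<Longrightarrow>
      (\<Sum>m<n. complex_of_real (r i m) * p j m) = (\<Sum>l<n. B l j * p l i)"
    and ls0: "ls ! 0 = 1" and len: "length ls = n"

lemma schur_basis:
  assumes R: "R \<in> carrier_mat n n" and ls: "eigenvalue_listing R ls"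
  shows "\<exists>p B Y. schur_data n (\<lambda>i j. R $$ (i, j)) ls p B Y"
proof -
  have A: "cmat R \<in> carrier_mat n n" using R by simp
  obtain B X Y where "schur_decomposition (cmat R) ls = (B, X, Y)" by (metis prod_cases3)
  then have wit: "similar_mat_wit (cmat R) B X Y" and tri: "upper_triangular B"
    and diag: "diag_mat B = ls"
    using schur_decomposition[OF A, of ls] ls by (auto simp: eigenvalue_listing_def)
  have n: "n = dim_row (cmat R)" using R by simp
  note w = similar_mat_witD[OF n wit]
  have "cmat R * X = X * B * Y * X" using w(3) by simp
  also have "\<dots> = X * B * (Y * X)" using w by (intro assoc_mult_mat) auto
  also have "\<dots> = X * B" unfolding w(2) using w by simp
  finally have AX: "cmat R * X = X * B" .
  have entry: "(C * D) $$ (i, j) = (\<Sum>m<n. C $$ (i, m) * D $$ (m, j))"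
    if "C \<in> carrier_mat n n" "D \<in> carrier_mat n n" "i < n" "j < n" for C D :: "complex mat" and i j
    using that by (simp add: scalar_prod_def lessThan_atLeast0)
  show ?thesis
  proof (rule exI[of _ "\<lambda>j i. X $$ (i, j)"], rule exI[of _ "\<lambda>l j. B $$ (l, j)"],
      rule exI[of _ "\<lambda>j i. Y $$ (j, i)"], unfold_locales)
    fix j l assume "j < n" "l < n"
    then show "(\<Sum>i<n. Y $$ (j, i) * X $$ (i, l)) = (if j = l then 1 else 0)"
      using entry[of Y X j l] w by simp
  next
    fix i m assume "i < n" "m < n"
    then show "(\<Sum>j<n. X $$ (i, j) * Y $$ (j, m)) = (if i = m then 1 else 0)"
      using entry[of X Y i m] w by simp
  next
    fix j l assume "j < l" "l < n"
    then show "B $$ (l, j) = 0" using upper_triangularD[OF tri, of j l] w(5) by simp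
  next
    fix j assume "j < n"
    then show "B $$ (j, j) = ls ! j" using diag[symmetric] w(5) by (simp add: diag_mat_def)
  next
    fix i j assume ij: "i < n" "j < n"
    have "(\<Sum>m<n. complex_of_real (R $$ (i, m)) * X $$ (m, j)) = (cmat R * X) $$ (i, j)"
      using ij R by (simp only: entry[OF A w(6)]) simp
    also have "\<dots> = (\<Sum>l<n. X $$ (i, l) * B $$ (l, j))"
      unfolding AX using ij entry[of X B i j] w by simp
    finally show "(\<Sum>m<n. complex_of_real (R $$ (i, m)) * X $$ (m, j)) = (\<Sum>l<n. B $$ (l, j) * X $$ (i, l))"
      by (simp add: mult.commute)
  qed (use ls R in \<open>auto simp: eigenvalue_listing_def\<close>)
qed

lemma eigenvalue_listing_norm_le_one:
  assumes R: "R \<in> carrier_mat n n" and n: "0 < n" and PF: "PF_eigenvalue R 1"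
    and ls: "eigenvalue_listing R ls" and l: "l \<in> set ls"
  shows "cmod l \<le> 1"
proof -
  have A: "cmat R \<in> carrier_mat n n" using R by simp
  have "poly (char_poly (cmat R)) l = 0"
    using ls l by (simp add: eigenvalue_listing_def linear_poly_root)
  then have "eigenvalue (cmat R) l" using eigenvalue_root_char_poly[OF A] by simp
  then have "cmod l \<in> cmod ` spectrum (cmat R)" by (simp add: spectrum_def)
  then have "cmod l \<le> spectral_radius (cmat R)" by (rule spectral_radius_mem_max(2)[OF A n])
  then show ?thesis using PF by (simp add: PF_eigenvalue_def)
qed

lemma eigenvalue_listing_Re_le:
  assumes "eigenvalue_listing R ls" "1 \<le> j" "j < length ls"
  shows "Re (ls ! j) \<le> Re (ls ! 1)"
proof -
  have sorted: "sorted_wrt (\<lambda>x y. Re x \<ge> Re y) (tl ls)"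
    using assms by (simp add: eigenvalue_listing_def)
  have nth: "tl ls ! i = ls ! Suc i" if "Suc i < length ls" for i
    using that by (simp add: nth_tl)
  show ?thesis
  proof (cases "j = 1")
    case False
    then have "Re (tl ls ! (j - 1)) \<le> Re (tl ls ! 0)"
      using sorted_wrt_nth_less[OF sorted, of 0 "j - 1"] assms by simp
    then show ?thesis using nth[of 0] nth[of "j - 1"] assms by simp
  qed simp
qed

section \<open>Fixed vectors and the second eigenvector in a Schur basis\<close>

context schur_data
begin

lemma fixed_vector_unique:
  assumes gap: "\<And>j. 1 \<le> j \<Longrightarrow> j < n \<Longrightarrow> Re (ls ! j) < 1"
    and y: "\<And>i. i < n \<Longrightarrow> (\<Sum>m<n. r i m * y m) = y i" and n: "0 < n"
  shows "\<exists>a. \<forall>i<n. complex_of_real (y i) = a * p 0 i"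
proof -
  define a where "a j = (\<Sum>m<n. Y j m * of_real (y m))" for j
  have ya: "complex_of_real (y i) = (\<Sum>j<n. a j * p j i)" if "i < n" for i
  proof -
    have "(\<Sum>j<n. a j * p j i) = (\<Sum>m<n. (\<Sum>j<n. p j i * Y j m) * of_real (y m))"
      unfolding a_def sum_distrib_right by (subst sum.swap) (simp add: mult_ac)
    also have "\<dots> = (\<Sum>m<n. if i = m then of_real (y m) else 0)"
      using that by (intro sum.cong refl) (simp add: dual')
    finally show ?thesis using that by (simp add: sum.delta)
  qed
  have ra: "complex_of_real (y i) = (\<Sum>l<n. (\<Sum>j<n. B l j * a j) * p l i)" if i: "i < n" for i
  proof -
    have "complex_of_real (y i) = (\<Sum>m<n. of_real (r i m) * of_real (y m))"
      unfolding of_real_mult[symmetric] of_real_sum[symmetric] by (simp only: y[OF i])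
    also have "\<dots> = (\<Sum>m<n. of_real (r i m) * (\<Sum>j<n. a j * p j m))"
      by (intro sum.cong refl) (simp add: ya)
    also have "\<dots> = (\<Sum>j<n. a j * (\<Sum>m<n. of_real (r i m) * p j m))"
      unfolding sum_distrib_left by (subst sum.swap) (simp add: mult_ac)
    also have "\<dots> = (\<Sum>j<n. a j * (\<Sum>l<n. B l j * p l i))"
      using i by (intro sum.cong refl) (simp add: triangular)
    also have "\<dots> = (\<Sum>l<n. (\<Sum>j<n. B l j * a j) * p l i)"
      unfolding sum_distrib_left sum_distrib_right by (subst sum.swap) (simp add: mult_ac)
    finally show ?thesis .
  qed
  have a_fixed: "a l = (\<Sum>j<n. B l j * a j)" if l: "l < n" for l
  proof -
    have "a l = (\<Sum>i<n. Y l i * (\<Sum>k<n. (\<Sum>j<n. B k j * a j) * p k i))"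
      unfolding a_def[of l] by (intro sum.cong refl) (simp add: ra)
    also have "\<dots> = (\<Sum>k<n. (\<Sum>j<n. B k j * a j) * (\<Sum>i<n. Y l i * p k i))"
      unfolding sum_distrib_left by (subst sum.swap) (simp add: mult_ac)
    also have "\<dots> = (\<Sum>k<n. if l = k then (\<Sum>j<n. B k j * a j) else 0)"
      using l by (intro sum.cong refl) (simp add: dual)
    finally show ?thesis using l by (simp add: sum.delta)
  qed
  have B1: "B j j \<noteq> 1" if "1 \<le> j" "j < n" for j using gap[OF that] diag that by auto
  have a0: "a l = 0" if "1 \<le> l" "l < n" for l
    by (rule upper_triangular_fixed_vector[of n B a, OF tri B1 a_fixed that])
  show ?thesis
  proof (rule exI[of _ "a 0"], intro allI impI)
    fix i assume i: "i < n"
    have "(\<Sum>j<n. a j * p j i) = (\<Sum>j<n. if j = 0 then a 0 * p 0 i else 0)"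
      using a0 by (intro sum.cong refl) auto
    then show "complex_of_real (y i) = a 0 * p 0 i" using n ya[OF i] by (simp add: sum.delta)
  qed
qed

text \<open>The functional \<mu> given by \<open>u\<close> is invariant under the matrix. For
  \<lambda> = \<open>ls ! 1\<close> other than 1 this forces \<mu> to vanish on eigenvectors; for
  \<lambda> = 1 the leading 2 by 2 block has to be inspected.\<close>

lemma second_eigenvector:
  fixes u :: "nat \<Rightarrow> real"
  assumes n: "2 \<le> n" and u: "\<And>j. j < n \<Longrightarrow> (\<Sum>i<n. u i * r i j) = u j"
  shows "\<exists>y. (\<exists>i<n. y i \<noteq> 0) \<and> (\<forall>i<n. (\<Sum>m<n. complex_of_real (r i m) * y m) = ls ! 1 * y i)
    \<and> (\<Sum>i<n. complex_of_real (u i) * y i) = 0"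
proof -
  define \<mu> where "\<mu> y = (\<Sum>i<n. complex_of_real (u i) * y i)" for y
  have \<mu>_op: "\<mu> (\<lambda>i. \<Sum>m<n. complex_of_real (r i m) * y m) = \<mu> y" for y
  proof -
    have "\<mu> (\<lambda>i. \<Sum>m<n. complex_of_real (r i m) * y m) = (\<Sum>m<n. of_real (\<Sum>i<n. u i * r i m) * y m)"
      unfolding \<mu>_def sum_distrib_left of_real_sum sum_distrib_right
      by (subst sum.swap) (simp add: mult_ac)
    then show ?thesis by (simp add: u \<mu>_def)
  qed
  have op0: "(\<Sum>m<n. complex_of_real (r i m) * p 0 m) = p 0 i" if "i < n" for i
  proof -
    have "(\<Sum>l<n. B l 0 * p l i) = (\<Sum>l<n. if l = 0 then p 0 i else 0)"
      using tri[of 0] diag[of 0] ls0 n by (intro sum.cong refl) auto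
    then show ?thesis using triangular[of i 0] that n by (simp add: sum.delta)
  qed
  have op1: "(\<Sum>m<n. complex_of_real (r i m) * p 1 m) = B 0 1 * p 0 i + ls ! 1 * p 1 i" if "i < n" for i
  proof -
    have "(\<Sum>l<n. B l 1 * p l i) = (\<Sum>l\<in>{0, 1}. B l 1 * p l i)"
      using n tri[of 1] by (intro sum.mono_neutral_right) auto
    then show ?thesis using triangular[of i 1] that n diag[of 1] by simp
  qed
  have nz: "\<exists>i<n. p 1 i + c * p 0 i \<noteq> 0" for c
  proof (rule ccontr)
    assume "\<not> ?thesis"
    then have "(\<Sum>i<n. Y 1 i * (p 1 i + c * p 0 i)) = 0" by (intro sum.neutral) auto
    moreover have "(\<Sum>i<n. Y 1 i * (p 1 i + c * p 0 i)) = (\<Sum>i<n. Y 1 i * p 1 i) + c * (\<Sum>i<n. Y 1 i * p 0 i)"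
      by (simp add: distrib_left sum.distrib sum_distrib_left mult_ac)
    ultimately show False using dual[of 1 1] dual[of 1 0] n by simp
  qed
  have nz0: "\<exists>i<n. p 0 i \<noteq> 0"
  proof (rule ccontr)
    assume "\<not> ?thesis"
    then have "(\<Sum>i<n. Y 0 i * p 0 i) = 0" by (intro sum.neutral) auto
    then show False using dual[of 0 0] n by simp
  qed
  have op: "(\<Sum>m<n. complex_of_real (r i m) * (p 1 m + c * p 0 m)) = ls ! 1 * p 1 i + (B 0 1 + c) * p 0 i"
    if "i < n" for i c
    using op0[OF that] op1[OF that]
    by (simp add: distrib_left distrib_right sum.distrib mult.left_commute[of _ c]
        sum_distrib_left[symmetric])
  have \<mu>_lin: "\<mu> (\<lambda>i. a * f i + b * g i) = a * \<mu> f + b * \<mu> g" for a b f g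
    by (simp add: \<mu>_def distrib_left sum.distrib sum_distrib_left mult_ac)
  show ?thesis
  proof (cases "ls ! 1 = 1")
    case False
    \<comment> \<open>\<open>c\<close> diagonalizes the leading block: it solves B 0 1 + c =
      \<lambda> c.\<close>
    define c where "c = B 0 1 / (ls ! 1 - 1)"
    define y where "y i = p 1 i + c * p 0 i" for i
    have "B 0 1 + c = ls ! 1 * c" using False by (simp add: c_def field_simps)
    then have eig: "(\<Sum>m<n. complex_of_real (r i m) * y m) = ls ! 1 * y i" if "i < n" for i
      using op[OF that] by (simp add: y_def distrib_left)
    have "\<mu> (\<lambda>i. \<Sum>m<n. complex_of_real (r i m) * y m) = ls ! 1 * \<mu> y"
    proof -
      have "\<mu> (\<lambda>i. \<Sum>m<n. complex_of_real (r i m) * y m) = (\<Sum>i<n. ls ! 1 * (of_real (u i) * y i))"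
        unfolding \<mu>_def by (intro sum.cong refl) (simp add: eig)
      then show ?thesis by (simp add: \<mu>_def sum_distrib_left)
    qed
    then have "\<mu> y = ls ! 1 * \<mu> y" by (simp add: \<mu>_op)
    then have "(ls ! 1 - 1) * \<mu> y = 0" by (simp add: left_diff_distrib)
    then have "\<mu> y = 0" using False by simp
    moreover have "\<exists>i<n. y i \<noteq> 0" using nz[of c] by (simp add: y_def)
    ultimately show ?thesis using eig unfolding \<mu>_def by (intro exI[of _ y]) simp
  next
    case True
    show ?thesis
    proof (cases "\<mu> (p 0) = 0")
      case True
      then show ?thesis using op0 nz0 \<open>ls ! 1 = 1\<close> unfolding \<mu>_def by (intro exI[of _ "p 0"]) simp
    next
      case False
      define c where "c = - (\<mu> (p 1) / \<mu> (p 0))"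
      define y where "y i = p 1 i + c * p 0 i" for i
      \<comment> \<open>Invariance of \<mu> excludes a Jordan block: \<mu> (p 1) = B 0 1 \<mu> (p 0)
        + \<mu> (p 1). The multiple \<open>c\<close> of \<open>p 0\<close> then only restores mean
        zero.\<close>
      have "\<mu> (\<lambda>i. \<Sum>m<n. complex_of_real (r i m) * p 1 m) = \<mu> (\<lambda>i. B 0 1 * p 0 i + ls ! 1 * p 1 i)"
        unfolding \<mu>_def by (intro sum.cong refl) (simp only: op1 lessThan_iff)
      then have "B 0 1 * \<mu> (p 0) = 0" unfolding \<mu>_op \<mu>_lin using True by simp
      then have "B 0 1 = 0" using False by simp
      then have eig: "(\<Sum>m<n. complex_of_real (r i m) * y m) = ls ! 1 * y i" if "i < n" for i
        using op[OF that] True by (simp add: y_def)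
      have "\<mu> y = 0"
        using \<mu>_lin[of 1 "p 1" c "p 0"] False by (simp add: y_def[abs_def] c_def)
      moreover have "\<exists>i<n. y i \<noteq> 0" using nz[of c] by (simp add: y_def)
      ultimately show ?thesis using eig unfolding \<mu>_def by (intro exI[of _ y]) simp
    qed
  qed
qed

end

section \<open>Sign of the fixed vector\<close>

lemma norm_half_one_plus:
  fixes l :: complex
  assumes "cmod l \<le> 1"
  shows "cmod ((1 + l) / 2) \<le> 1" "Re l < 1 \<Longrightarrow> cmod ((1 + l) / 2) < 1"
proof -
  have "(cmod l)\<^sup>2 \<le> 1" using assms by (simp add: power_le_one)
  then have sq: "(cmod (1 + l))\<^sup>2 \<le> 2 + 2 * Re l"
    unfolding cmod_power2 by (simp add: power2_eq_square algebra_simps)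
  have Re: "Re l \<le> 1" using assms complex_Re_le_cmod[of l] by linarith
  have "(cmod (1 + l))\<^sup>2 \<le> 2\<^sup>2" using sq Re by simp
  then have "cmod (1 + l) \<le> 2" by (rule power2_le_imp_le) simp
  then show "cmod ((1 + l) / 2) \<le> 1" by (simp add: norm_divide)
  assume "Re l < 1"
  then have "(cmod (1 + l))\<^sup>2 < 2\<^sup>2" using sq by simp
  then have "cmod (1 + l) < 2" by (rule power2_less_imp_less) simp
  then show "cmod ((1 + l) / 2) < 1" by (simp add: norm_divide)
qed

context schur_data
begin

text \<open>The gap hypothesis still admits eigenvalues such as -1 on the unit circle. Averaging
  with the identity moves them into the open disc and leaves 1 in place.\<close>

definition lazy :: "(nat \<Rightarrow> real) \<Rightarrow> nat \<Rightarrow> real" where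
  "lazy f i = (f i + (\<Sum>m<n. r i m * f m)) / 2"

lemma lazy_powers_bounded:
  assumes norm: "\<And>l. l \<in> set ls \<Longrightarrow> cmod l \<le> 1"
    and gap: "\<And>j. 1 \<le> j \<Longrightarrow> j < n \<Longrightarrow> Re (ls ! j) < 1"
  shows "\<exists>C. \<forall>k. \<forall>i<n. \<bar>(lazy ^^ k) g i\<bar> \<le> C"
proof -
  define M where "M = mat n n (\<lambda>(i, j). ((if i = j then 1 else 0) + complex_of_real (r i j)) / 2)"
  define T where "T = mat n n (\<lambda>(i, j). ((if i = j then 1 else 0) + B i j) / 2)"
  define X where "X = mat n n (\<lambda>(i, j). p j i)"
  define Z where "Z = mat n n (\<lambda>(j, i). Y j i)"
  have carr: "M \<in> carrier_mat n n" "T \<in> carrier_mat n n" "X \<in> carrier_mat n n" "Z \<in> carrier_mat n n"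
    by (simp_all add: M_def T_def X_def Z_def)
  have entry: "(C * D) $$ (i, j) = (\<Sum>m<n. C $$ (i, m) * D $$ (m, j))"
    if "C \<in> carrier_mat n n" "D \<in> carrier_mat n n" "i < n" "j < n" for C D :: "complex mat" and i j
    using that by (simp add: scalar_prod_def lessThan_atLeast0)
  have XZ: "X * Z = 1\<^sub>m n"
  proof (rule eq_matI)
    fix i j assume "i < dim_row (1\<^sub>m n)" "j < dim_col (1\<^sub>m n)"
    then have ij: "i < n" "j < n" by auto
    have "(X * Z) $$ (i, j) = (\<Sum>m<n. p m i * Y m j)"
      unfolding entry[OF carr(3,4) ij] using ij by (intro sum.cong refl) (simp add: X_def Z_def)
    then show "(X * Z) $$ (i, j) = 1\<^sub>m n $$ (i, j)" using ij by (simp add: dual')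
  qed (use carr in auto)
  have ZX: "Z * X = 1\<^sub>m n"
  proof (rule eq_matI)
    fix i j assume "i < dim_row (1\<^sub>m n)" "j < dim_col (1\<^sub>m n)"
    then have ij: "i < n" "j < n" by auto
    have "(Z * X) $$ (i, j) = (\<Sum>m<n. Y i m * p j m)"
      unfolding entry[OF carr(4,3) ij] using ij by (intro sum.cong refl) (simp add: X_def Z_def)
    then show "(Z * X) $$ (i, j) = 1\<^sub>m n $$ (i, j)" using ij by (simp add: dual)
  qed (use carr in auto)
  have MX: "M * X = X * T"
  proof (rule eq_matI)
    fix i j assume "i < dim_row (X * T)" "j < dim_col (X * T)"
    then have ij: "i < n" "j < n" using carr by auto
    have "(M * X) $$ (i, j) = (\<Sum>m<n. ((if i = m then p j m else 0) + of_real (r i m) * p j m) / 2)"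
      unfolding entry[OF carr(1,3) ij] using ij
      by (intro sum.cong refl) (auto simp: M_def X_def distrib_right)
    also have "\<dots> = (p j i + (\<Sum>m<n. of_real (r i m) * p j m)) / 2"
      using ij by (simp add: sum_divide_distrib[symmetric] sum.distrib sum.delta)
    also have "\<dots> = (p j i + (\<Sum>l<n. B l j * p l i)) / 2" using ij by (simp only: triangular)
    also have "\<dots> = (\<Sum>m<n. ((if m = j then p m i else 0) + B m j * p m i) / 2)"
      using ij by (simp add: sum_divide_distrib[symmetric] sum.distrib sum.delta)
    also have "\<dots> = (X * T) $$ (i, j)"
      unfolding entry[OF carr(3,2) ij] using ij
      by (intro sum.cong refl) (auto simp: T_def X_def distrib_right algebra_simps)
    finally show "(M * X) $$ (i, j) = (X * T) $$ (i, j)" .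
  qed (use carr in auto)
  have "M = M * (X * Z)" using carr XZ by simp
  also have "\<dots> = X * T * Z" using carr MX assoc_mult_mat[OF carr(1,3,4)] by simp
  finally have "M = X * T * Z" .
  then have sim: "similar_mat M T"
    unfolding similar_mat_def using similar_mat_witI[OF XZ ZX _ carr] by blast
  have tri_T: "upper_triangular T"
  proof (rule upper_triangularI)
    fix i j assume "j < i" "i < dim_row T"
    then show "T $$ (i, j) = 0" using tri[of j i] carr by (auto simp: T_def)
  qed
  define as where "as = map (\<lambda>l. (1 + l) / 2) ls"
  have "diag_mat T = as"
    unfolding diag_mat_def as_def using carr diag len
    by (intro nth_equalityI) (auto simp: T_def)
  then have cp: "char_poly M = (\<Prod>a\<leftarrow>as. [:- a, 1:])"
    using char_poly_similar[OF sim] char_poly_upper_triangular[OF carr(2) tri_T] by simp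
  have small: "cmod ((1 + l) / 2) < 1" if l: "l \<in> set (tl ls)" for l
  proof -
    obtain j where "j < length (tl ls)" "l = tl ls ! j" using l by (metis in_set_conv_nth)
    then have "Suc j < n" "l = ls ! Suc j" using len by (auto simp: nth_tl)
    then show ?thesis using gap[of "Suc j"] norm[of l] len norm_half_one_plus(2)[of l] by auto
  qed
  \<comment> \<open>Growth is polynomial of degree one less than the multiplicity on the unit
    circle. Only the first listed eigenvalue can have modulus 1, so the exponent is 0 and the bound
    is constant.\<close>
  have "\<exists>c1 c2. \<forall>k. norm_bound (M ^\<^sub>m k) (c1 + c2 * real k ^ (1 - 1))"
  proof (rule factored_char_poly_norm_bound_cof[OF carr(1) cp])
    show "cmod a \<le> 1" if "a \<in> set as" for a
      using that norm norm_half_one_plus(1) by (auto simp: as_def)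
    fix a assume a: "a \<in> set as" "cmod a = 1"
    have "filter ((=) a) (map (\<lambda>l. (1 + l) / 2) (tl ls)) = []"
      unfolding filter_empty_conv using small a(2) by force
    then show "length (filter ((=) a) as) \<le> 1"
      unfolding as_def by (cases ls) auto
  qed
  then obtain c where c: "\<And>k. norm_bound (M ^\<^sub>m k) c" by auto
  have pow: "(M ^\<^sub>m k) *\<^sub>v vec n (\<lambda>i. complex_of_real (f i)) = vec n (\<lambda>i. of_real ((lazy ^^ k) f i))" for k f
  proof (induction k arbitrary: f)
    case 0
    show ?case using carr by simp
  next
    case (Suc k)
    have one: "M *\<^sub>v vec n (\<lambda>i. complex_of_real (f i)) = vec n (\<lambda>i. of_real (lazy f i))"
    proof (rule eq_vecI)
      fix i assume "i < dim_vec (vec n (\<lambda>i. complex_of_real (lazy f i)))"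
      then have i: "i < n" by simp
      have "(M *\<^sub>v vec n (\<lambda>i. complex_of_real (f i))) $ i = (\<Sum>m<n. M $$ (i, m) * of_real (f m))"
        using i carr by (simp add: scalar_prod_def lessThan_atLeast0)
      also have "\<dots> = (\<Sum>m<n. ((if i = m then of_real (f m) else 0) + of_real (r i m * f m)) / 2)"
        using i by (intro sum.cong refl) (auto simp: M_def distrib_right)
      also have "\<dots> = of_real (lazy f i)"
        using i by (simp add: lazy_def sum_divide_distrib[symmetric] sum.distrib sum.delta)
      finally show "(M *\<^sub>v vec n (\<lambda>i. complex_of_real (f i))) $ i = vec n (\<lambda>i. of_real (lazy f i)) $ i"
        using i by simp
    qed (use carr in simp)
    have "(M ^\<^sub>m Suc k) *\<^sub>v vec n (\<lambda>i. complex_of_real (f i))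
        = (M ^\<^sub>m k) *\<^sub>v (M *\<^sub>v vec n (\<lambda>i. complex_of_real (f i)))"
      using carr by (simp add: assoc_mult_mat_vec[of _ n n _ n])
    also have "\<dots> = vec n (\<lambda>i. of_real ((lazy ^^ k) (lazy f) i))" unfolding one by (rule Suc)
    finally show ?case by (simp add: funpow_swap1)
  qed
  show ?thesis
  proof (rule exI[of _ "\<Sum>j<n. c * \<bar>g j\<bar>"], intro allI impI)
    fix k i assume i: "i < n"
    have Mk: "M ^\<^sub>m k \<in> carrier_mat n n" using carr by simp
    have "complex_of_real ((lazy ^^ k) g i) = ((M ^\<^sub>m k) *\<^sub>v vec n (\<lambda>i. complex_of_real (g i))) $ i"
      unfolding pow using i by simp
    also have "\<dots> = (\<Sum>j<n. (M ^\<^sub>m k) $$ (i, j) * of_real (g j))"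
      using i carrier_matD[OF Mk] by (simp add: scalar_prod_def lessThan_atLeast0)
    finally have eq: "complex_of_real ((lazy ^^ k) g i) = (\<Sum>j<n. (M ^\<^sub>m k) $$ (i, j) * of_real (g j))" .
    have "\<bar>(lazy ^^ k) g i\<bar> = cmod (complex_of_real ((lazy ^^ k) g i))" by simp
    also have "\<dots> \<le> (\<Sum>j<n. cmod ((M ^\<^sub>m k) $$ (i, j) * of_real (g j)))"
      unfolding eq by (rule norm_sum)
    also have "\<dots> \<le> (\<Sum>j<n. c * \<bar>g j\<bar>)"
      using c[of k] i carrier_matD[OF carr(1)] unfolding norm_bound_def
      by (intro sum_mono) (auto simp: norm_mult intro!: mult_right_mono)
    finally show "\<bar>(lazy ^^ k) g i\<bar> \<le> (\<Sum>j<n. c * \<bar>g j\<bar>)" .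
  qed
qed

text \<open>
  Since \<open>|v|\<close> is subinvariant under the lazy map, it lies below its Cesaro averages, and these
  converge to the multiple \<open>\<alpha> v\<close> of the fixed vector.
\<close>

lemma fixed_vector_constant_sign:
  fixes u v :: "nat \<Rightarrow> real"
  assumes n: "0 < n" and r: "\<And>i j. i < n \<Longrightarrow> j < n \<Longrightarrow> 0 \<le> r i j"
    and norm: "\<And>l. l \<in> set ls \<Longrightarrow> cmod l \<le> 1"
    and gap: "\<And>j. 1 \<le> j \<Longrightarrow> j < n \<Longrightarrow> Re (ls ! j) < 1"
    and v: "\<And>i. i < n \<Longrightarrow> (\<Sum>m<n. r i m * v m) = v i"
    and u: "\<And>j. j < n \<Longrightarrow> (\<Sum>i<n. u i * r i j) = u j"
    and uv: "(\<Sum>i<n. u i * v i) = 1"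
  shows "\<exists>\<alpha>. \<forall>i<n. \<bar>v i\<bar> \<le> \<alpha> * v i"
proof -
  \<comment> \<open>I - R plus the rank one matrix of \<open>v\<close> and \<open>u\<close>. A
    kernel vector is annihilated by \<open>u\<close> (apply \<open>u\<close> to the equation), hence
    fixed by R, hence a multiple of \<open>p 0\<close>; but \<open>u\<close> does not annihilate
    \<open>p 0\<close>, because u v = 1.\<close>
  define N where "N = mat n n (\<lambda>(i, j). (if i = j then 1 else 0) - r i j + v i * u j)"
  have N: "N \<in> carrier_mat n n" by (simp add: N_def)
  have Nx: "(N *\<^sub>v x) $ i = x $ i - (\<Sum>m<n. r i m * x $ m) + v i * (\<Sum>m<n. u m * x $ m)"
    if "x \<in> carrier_vec n" "i < n" for x i
  proof -
    have "(N *\<^sub>v x) $ i = (\<Sum>m<n. N $$ (i, m) * x $ m)"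
      using that N by (simp add: scalar_prod_def lessThan_atLeast0)
    also have "\<dots> = (\<Sum>m<n. (if i = m then x $ m else 0) - r i m * x $ m + v i * (u m * x $ m))"
      using that by (intro sum.cong refl) (auto simp: N_def algebra_simps)
    finally show ?thesis
      using that by (simp add: sum.distrib sum_subtractf sum.delta sum_distrib_left)
  qed
  have "det N \<noteq> 0"
  proof
    assume "det N = 0"
    then obtain x where x: "x \<in> carrier_vec n" "x \<noteq> 0\<^sub>v n" "N *\<^sub>v x = 0\<^sub>v n"
      using det_0_iff_vec_prod_zero[OF N] by blast
    define \<beta> where "\<beta> = (\<Sum>m<n. u m * x $ m)"
    have e: "x $ i - (\<Sum>m<n. r i m * x $ m) + v i * \<beta> = 0" if "i < n" for i
      using Nx[OF x(1) that] that unfolding x(3) by (simp add: \<beta>_def)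
    have swap: "(\<Sum>i<n. u i * (\<Sum>m<n. r i m * x $ m)) = \<beta>"
    proof -
      have "(\<Sum>i<n. u i * (\<Sum>m<n. r i m * x $ m)) = (\<Sum>m<n. (\<Sum>i<n. u i * r i m) * x $ m)"
        unfolding sum_distrib_left sum_distrib_right by (subst sum.swap) (simp add: mult_ac)
      then show ?thesis by (simp add: u \<beta>_def)
    qed
    have "0 = (\<Sum>i<n. u i * (x $ i - (\<Sum>m<n. r i m * x $ m) + v i * \<beta>))"
      using e by simp
    also have "\<dots> = \<beta> - \<beta> + (\<Sum>i<n. u i * v i) * \<beta>"
      unfolding distrib_left right_diff_distrib sum.distrib sum_subtractf swap
      by (simp add: \<beta>_def sum_distrib_right mult.assoc)
    finally have \<beta>0: "\<beta> = 0" using uv by simp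
    then have xf: "(\<Sum>m<n. r i m * x $ m) = x $ i" if "i < n" for i using e[OF that] by simp
    obtain a where a: "\<forall>i<n. complex_of_real (x $ i) = a * p 0 i"
      using fixed_vector_unique[of "\<lambda>i. x $ i"] gap xf n by blast
    obtain b where b: "\<forall>i<n. complex_of_real (v i) = b * p 0 i"
      using fixed_vector_unique[of v] gap v n by blast
    define s where "s = (\<Sum>i<n. complex_of_real (u i) * p 0 i)"
    have "complex_of_real 1 = (\<Sum>i<n. of_real (u i) * of_real (v i))"
      unfolding uv[symmetric] by simp
    also have "\<dots> = b * s" unfolding s_def sum_distrib_left using b by (intro sum.cong refl) simp
    finally have "s \<noteq> 0" by auto
    have "complex_of_real \<beta> = (\<Sum>i<n. of_real (u i) * of_real (x $ i))"
      unfolding \<beta>_def by simp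
    also have "\<dots> = a * s" unfolding s_def sum_distrib_left using a by (intro sum.cong refl) simp
    finally have "a = 0" using \<beta>0 \<open>s \<noteq> 0\<close> by simp
    then have "x $ i = 0" if "i < n" for i using a that by simp
    then have "x = 0\<^sub>v n" using x(1) by (intro eq_vecI) auto
    then show False using x(2) by simp
  qed
  define z where "z = vec n (\<lambda>i. \<bar>v i\<bar>)"
  define y where "y = inverse (det N) \<cdot>\<^sub>v (adj_mat N *\<^sub>v z)"
  have z: "z \<in> carrier_vec n" by (simp add: z_def)
  note adj = adj_mat[OF N]
  have y: "y \<in> carrier_vec n" using adj(1) z by (simp add: y_def)
  have "N *\<^sub>v y = inverse (det N) \<cdot>\<^sub>v ((N * adj_mat N) *\<^sub>v z)"
    using N adj(1) z by (simp add: y_def mult_mat_vec assoc_mult_mat_vec[of _ n n _ n])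
  also have "\<dots> = z"
    unfolding adj(2) using z \<open>det N \<noteq> 0\<close> by (intro eq_vecI) auto
  finally have Ny: "N *\<^sub>v y = z" .
  \<comment> \<open>The factor 2 undoes the halving in \<open>lazy\<close>: g - lazy g = y - R y.
    Thus |v| is \<alpha> v plus a difference whose iterates telescope.\<close>
  define g where "g i = 2 * y $ i" for i
  define \<alpha> where "\<alpha> = (\<Sum>m<n. u m * y $ m)"
  have abs_v: "\<bar>v i\<bar> = \<alpha> * v i + g i - lazy g i" if i: "i < n" for i
  proof -
    have "\<bar>v i\<bar> = y $ i - (\<Sum>m<n. r i m * y $ m) + v i * \<alpha>"
      using Nx[OF y i] i unfolding Ny by (simp add: z_def \<alpha>_def)
    moreover have "(\<Sum>m<n. r i m * g m) = 2 * (\<Sum>m<n. r i m * y $ m)"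
      by (simp add: g_def sum_distrib_left mult_ac)
    ultimately show ?thesis unfolding lazy_def by (simp only:) (simp add: g_def field_simps)
  qed
  define h where "h k = (lazy ^^ k) (\<lambda>i. \<bar>v i\<bar>)" for k
  have h: "h k i = \<alpha> * v i + (lazy ^^ k) g i - (lazy ^^ Suc k) g i" if "i < n" for k i
    using that
  proof (induction k arbitrary: i)
    case 0
    then show ?case using abs_v by (simp add: h_def)
  next
    case (Suc k)
    have "(\<Sum>m<n. r i m * h k m)
        = (\<Sum>m<n. r i m * (\<alpha> * v m + (lazy ^^ k) g m - (lazy ^^ Suc k) g m))"
      using Suc.IH by (intro sum.cong refl) simp
    also have "\<dots> = \<alpha> * (\<Sum>m<n. r i m * v m) + (\<Sum>m<n. r i m * (lazy ^^ k) g m)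
        - (\<Sum>m<n. r i m * (lazy ^^ Suc k) g m)"
      by (simp add: distrib_left right_diff_distrib sum.distrib sum_subtractf sum_distrib_left
          mult.left_commute)
    finally have "(\<Sum>m<n. r i m * h k m) = \<alpha> * v i + (\<Sum>m<n. r i m * (lazy ^^ k) g m)
        - (\<Sum>m<n. r i m * (lazy ^^ Suc k) g m)"
      using v[OF Suc.prems] by simp
    moreover have "h (Suc k) i = (h k i + (\<Sum>m<n. r i m * h k m)) / 2" by (simp add: h_def lazy_def)
    moreover have "(lazy ^^ Suc j) g i = ((lazy ^^ j) g i + (\<Sum>m<n. r i m * (lazy ^^ j) g m)) / 2" for j
      by (simp add: lazy_def)
    ultimately show ?case using Suc.IH[OF Suc.prems] by (simp only:) (simp add: field_simps)
  qed
  \<comment> \<open>Entries of R are nonnegative, so |v| = |R v| \<le> R |v|, and monotonicity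
    carries this through all iterates.\<close>
  have h_ge: "\<bar>v i\<bar> \<le> h k i" if "i < n" for k i
    using that
  proof (induction k arbitrary: i)
    case (Suc k)
    have "\<bar>v i\<bar> = \<bar>\<Sum>m<n. r i m * v m\<bar>" using v Suc.prems by simp
    also have "\<dots> \<le> (\<Sum>m<n. \<bar>r i m * v m\<bar>)" by (rule sum_abs)
    also have "\<dots> = (\<Sum>m<n. r i m * \<bar>v m\<bar>)"
      using r Suc.prems by (intro sum.cong refl) (simp add: abs_mult)
    also have "\<dots> \<le> (\<Sum>m<n. r i m * h k m)"
      using r Suc by (intro sum_mono mult_left_mono) auto
    finally show ?case using Suc.IH[OF Suc.prems] by (simp add: h_def lazy_def)
  qed (simp add: h_def)
  obtain C where C: "\<forall>k. \<forall>i<n. \<bar>(lazy ^^ k) g i\<bar> \<le> C"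
    using lazy_powers_bounded[of g] norm gap by blast
  show ?thesis
  proof (rule exI[of _ \<alpha>], intro allI impI)
    fix i assume i: "i < n"
    \<comment> \<open>Summing k iterates leaves only two boundary terms, bounded independently of k;
      a positive gap |v i| - \<alpha> v i would make the left side unbounded.\<close>
    have bound: "real k * (\<bar>v i\<bar> - \<alpha> * v i) \<le> 2 * C" for k
    proof -
      have "real k * \<bar>v i\<bar> = (\<Sum>j<k. \<bar>v i\<bar>)" by simp
      also have "\<dots> \<le> (\<Sum>j<k. h j i)" using h_ge i by (intro sum_mono) auto
      also have "\<dots> = (\<Sum>j<k. \<alpha> * v i + ((lazy ^^ j) g i - (lazy ^^ Suc j) g i))"
        using h i by (intro sum.cong refl) simp
      also have "\<dots> = real k * (\<alpha> * v i) + ((lazy ^^ 0) g i - (lazy ^^ k) g i)"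
        unfolding sum.distrib using sum_lessThan_telescope'[of "\<lambda>j. (lazy ^^ j) g i" k] by simp
      also have "(lazy ^^ 0) g i - (lazy ^^ k) g i \<le> \<bar>(lazy ^^ 0) g i\<bar> + \<bar>(lazy ^^ k) g i\<bar>" by simp
      also have "\<dots> \<le> C + C" using C i by (intro add_mono) blast+
      finally show ?thesis by (simp add: right_diff_distrib)
    qed
    show "\<bar>v i\<bar> \<le> \<alpha> * v i"
    proof (rule ccontr)
      assume "\<not> ?thesis"
      then obtain k where "2 * C < real k * (\<bar>v i\<bar> - \<alpha> * v i)"
        using reals_Archimedean3[of "\<bar>v i\<bar> - \<alpha> * v i"] by auto
      then show False using bound[of k] by simp
    qed
  qed
qed

end

section \<open>Edge expansion and spectral gap\<close>

lemma eigenvector_smult: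
  fixes A :: "'a :: field mat"
  assumes A: "A \<in> carrier_mat n n" and x: "eigenvector A x k" and c: "c \<noteq> 0"
  shows "eigenvector A (c \<cdot>\<^sub>v x) k"
proof -
  have xn: "x \<in> carrier_vec n" "x \<noteq> 0\<^sub>v n" "A *\<^sub>v x = k \<cdot>\<^sub>v x"
    using A x by (auto simp: eigenvector_def)
  have "c \<cdot>\<^sub>v x \<noteq> 0\<^sub>v n"
  proof
    assume "c \<cdot>\<^sub>v x = 0\<^sub>v n"
    then have "x $ i = 0" if "i < n" for i using that xn(1) c
      by (metis carrier_vecD index_smult_vec(1) index_zero_vec(1) mult_eq_0_iff)
    then have "x = 0\<^sub>v n" using xn(1) by (intro eq_vecI) auto
    then show False using xn(2) by simp
  qed
  moreover have "A *\<^sub>v (c \<cdot>\<^sub>v x) = k \<cdot>\<^sub>v (c \<cdot>\<^sub>v x)"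
    using A xn by (simp add: mult_mat_vec smult_smult_assoc mult.commute)
  ultimately show ?thesis using A xn(1) by (simp add: eigenvector_def)
qed

lemma right_eigenvector_sum:
  assumes "R \<in> carrier_mat n n" "right_eigenvector R v 1"
  shows "v \<in> carrier_vec n" "i < n \<Longrightarrow> (\<Sum>j<n. R $$ (i, j) * v $ j) = v $ i"
proof -
  show v: "v \<in> carrier_vec n"
    using assms by (auto simp: right_eigenvector_def eigenvector_def)
  assume i: "i < n"
  have "R *\<^sub>v v = v" using assms by (auto simp: right_eigenvector_def eigenvector_def)
  then have "(R *\<^sub>v v) $ i = v $ i" by simp
  then show "(\<Sum>j<n. R $$ (i, j) * v $ j) = v $ i"
    using assms(1) v i by (simp add: scalar_prod_def lessThan_atLeast0)
qed

lemma left_eigenvector_sum: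
  assumes R: "R \<in> carrier_mat n n" and u: "left_eigenvector R u 1"
  shows "u \<in> carrier_vec n" "j < n \<Longrightarrow> (\<Sum>i<n. u $ i * R $$ (i, j)) = u $ j"
proof -
  have R': "transpose_mat R \<in> carrier_mat n n" using R by simp
  have u': "right_eigenvector (transpose_mat R) u 1"
    using u by (simp add: right_eigenvector_def left_eigenvector_def)
  show "u \<in> carrier_vec n" by (rule right_eigenvector_sum(1)[OF R' u'])
  assume j: "j < n"
  have "(\<Sum>i<n. u $ i * R $$ (i, j)) = (\<Sum>i<n. transpose_mat R $$ (j, i) * u $ i)"
    using R j by (intro sum.cong refl) (simp add: mult.commute)
  then show "(\<Sum>i<n. u $ i * R $$ (i, j)) = u $ j"
    using right_eigenvector_sum(2)[OF R' u' j] by simp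
qed

lemma positive_eigenpair_circulation:
  assumes R: "R \<in> carrier_mat n n" "nonneg_matrix R"
    and pos: "positive_eigenpair R (u, v)" and norm: "u \<bullet> v = 1"
  shows "circulation n (\<lambda>i j. R $$ (i, j) * u $ i * v $ j) (\<lambda>i. u $ i * v $ i)"
proof -
  have ev: "left_eigenvector R u 1" "right_eigenvector R v 1"
    using pos by (auto simp: positive_eigenpair_def)
  note u = left_eigenvector_sum[OF R(1) ev(1)] and v = right_eigenvector_sum[OF R(1) ev(2)]
  have pu: "0 < u $ i" and pv: "0 < v $ i" if "i < n" for i
    using pos that u(1) v(1) by (auto simp: positive_eigenpair_def positive_vec_def)
  show ?thesis
  proof
    fix i j assume ij: "i < n" "j < n"
    have "0 \<le> R $$ (i, j)" using R ij by (simp add: nonneg_matrix_def)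
    then show "0 \<le> R $$ (i, j) * u $ i * v $ j" using pu[OF ij(1)] pv[OF ij(2)] by simp
  next
    fix i assume i: "i < n"
    have "(\<Sum>j<n. R $$ (i, j) * u $ i * v $ j) = u $ i * (\<Sum>j<n. R $$ (i, j) * v $ j)"
      by (simp add: sum_distrib_left mult_ac)
    then show "(\<Sum>j<n. R $$ (i, j) * u $ i * v $ j) = u $ i * v $ i" using v(2)[OF i] by simp
    show "0 < u $ i * v $ i" using pu pv i by simp
  next
    fix j assume j: "j < n"
    have "(\<Sum>i<n. R $$ (i, j) * u $ i * v $ j) = (\<Sum>i<n. u $ i * R $$ (i, j)) * v $ j"
      unfolding sum_distrib_right by (intro sum.cong refl) (simp add: mult_ac)
    then show "(\<Sum>i<n. R $$ (i, j) * u $ i * v $ j) = u $ j * v $ j" using u(2)[OF j] by simp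
  next
    show "(\<Sum>i<n. u $ i * v $ i) = 1"
      using norm v(1) by (simp add: scalar_prod_def lessThan_atLeast0)
  qed
qed

lemma normalized_positive_eigenpair:
  assumes R: "R \<in> carrier_mat n n" and n: "0 < n" and pos: "positive_eigenpair R (u, v)"
  shows "\<exists>p. positive_eigenpair R p \<and> fst p \<bullet> snd p = 1"
proof -
  have ev: "left_eigenvector R u 1" "right_eigenvector R v 1"
    using pos by (auto simp: positive_eigenpair_def)
  have u: "u \<in> carrier_vec n" and v: "v \<in> carrier_vec n"
    using left_eigenvector_sum(1)[OF R ev(1)] right_eigenvector_sum(1)[OF R ev(2)] by auto
  define s where "s = u \<bullet> v"
  have s: "0 < s"
    unfolding s_def scalar_prod_def
    using n u v pos by (intro sum_pos) (auto simp: positive_eigenpair_def positive_vec_def)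
  have "right_eigenvector R (inverse s \<cdot>\<^sub>v v) 1"
    using eigenvector_smult[OF R, of v 1 "inverse s"] ev(2) s by (simp add: right_eigenvector_def)
  moreover have "positive_vec (inverse s \<cdot>\<^sub>v v)"
    using pos s by (simp add: positive_eigenpair_def positive_vec_def)
  ultimately have "positive_eigenpair R (u, inverse s \<cdot>\<^sub>v v)"
    using pos by (simp add: positive_eigenpair_def)
  moreover have "u \<bullet> (inverse s \<cdot>\<^sub>v v) = 1" using u v s by (simp add: s_def)
  ultimately show ?thesis by (intro exI[of _ "(u, inverse s \<cdot>\<^sub>v v)"]) simp
qed

context circulation
begin

text \<open>Two disjoint singletons cannot both have mass above 1/2. This makes the minimum in the
  expansion an attained value.\<close>

lemma expansion_family_nonempty:
  assumes "2 \<le> n"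
  shows "{S. S \<noteq> {} \<and> S \<subseteq> {..<n} \<and> sum \<pi> S \<le> 1 / 2} \<noteq> {}"
proof -
  have "sum \<pi> {0, 1} \<le> (\<Sum>i<n. \<pi> i)"
    using assms \<pi>_pos by (intro sum_mono2) (auto intro: less_imp_le)
  then have "\<pi> 0 + \<pi> 1 \<le> 1" by (simp add: \<pi>_total)
  then have "sum \<pi> {0} \<le> 1 / 2 \<or> sum \<pi> {1} \<le> 1 / 2" by auto
  then have "\<exists>i<n. sum \<pi> {i} \<le> 1 / 2" 
    using assms by (metis less_le_trans one_less_numeral_iff pos2 semiring_norm(76))
  then obtain i where "i < n" "sum \<pi> {i} \<le> 1 / 2" by blast
  then show ?thesis by (intro CollectI notI) (auto dest: equals0D[of _ "{i}"])
qed

end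

text \<open>At \<kappa> = 0 the logarithm is infinite and the lower bound reads 0; the
  \<open>if\<close> makes this explicit and extends it to negative \<kappa>. With n \<ge> 2 the
  entry \<open>ls ! 1\<close> exists.\<close>

theorem theorem5:
  fixes R :: "real mat" and n :: nat and u v :: "real vec"
    and \<kappa> :: real and ls :: "complex list"
  assumes "n \<ge> 2"
    and "R \<in> carrier_mat n n"
    and "nonneg_matrix R"
    and "PF_eigenvalue R 1"
    and "left_eigenvector R u 1"
    and "right_eigenvector R v 1"
    and "\<kappa> = Min ((\<lambda>i. u $ i * v $ i) ` {..<n})"
    and "\<kappa> > 0 \<Longrightarrow> u \<bullet> v = 1"
    and "eigenvalue_listing R ls"
  shows "(if \<kappa> > 0 then 1 / 30 * ((1 - Re (ls ! 1)) / (real n + ln (1 / \<kappa>))) else 0)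
           \<le> edge_expansion R
       \<and> edge_expansion R \<le> sqrt (2 * (1 - Re (ls ! 1)))"
proof -
  note n = assms(1) and R = assms(2) and nonneg = assms(3) and PF = assms(4) and ls = assms(9)
  define r where "r = (\<lambda>i j. R $$ (i, j))"
  define \<gamma> where "\<gamma> = 1 - Re (ls ! 1)"
  have len: "length ls = n" and ls0: "ls ! 0 = 1"
    using ls R by (auto simp: eigenvalue_listing_def)
  have norm: "cmod l \<le> 1" if "l \<in> set ls" for l
    using eigenvalue_listing_norm_le_one[OF R _ PF ls that] n by simp
  have "Re (ls ! 1) \<le> cmod (ls ! 1)" by (rule complex_Re_le_cmod)
  also have "\<dots> \<le> 1" using norm len n by simp
  finally have \<gamma>0: "0 \<le> \<gamma>" by (simp add: \<gamma>_def)
  have gap: "Re (ls ! j) \<le> 1 - \<gamma>" if "1 \<le> j" "j < n" for j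
    using eigenvalue_listing_Re_le[OF ls, of j] that len by (simp add: \<gamma>_def)
  obtain p B Y where "schur_data n r ls p B Y"
    using schur_basis[OF R ls] unfolding r_def by blast
  then interpret schur_data n r ls p B Y .
  have \<kappa>_le: "\<kappa> \<le> u $ i * v $ i" if "i < n" for i
    unfolding assms(7) using that by (intro Min_le) auto
  show ?thesis
  proof (cases "\<exists>q. positive_eigenpair R q")
    case True
    \<comment> \<open>The chosen pair may differ from \<open>u\<close> and \<open>v\<close>, which
      enter this case only through \<kappa> \<le> 1.\<close>
    define q where "q = (SOME q. positive_eigenpair R q \<and> fst q \<bullet> snd q = 1)"
    have "\<exists>q. positive_eigenpair R q \<and> fst q \<bullet> snd q = 1"
      using True normalized_positive_eigenpair[OF R] n by (metis less_le_trans pos2 surj_pair)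
    then have q: "positive_eigenpair R q \<and> fst q \<bullet> snd q = 1" unfolding q_def by (rule someI_ex)
    define a b where "a = fst q" and "b = snd q"
    have ab: "positive_eigenpair R (a, b)" "a \<bullet> b = 1" using q by (simp_all add: a_def b_def)
    define Q where "Q i j = R $$ (i, j) * a $ i * b $ j" for i j
    define \<pi> where "\<pi> i = a $ i * b $ i" for i
    interpret circulation n Q \<pi>
      using positive_eigenpair_circulation[OF R nonneg ab] unfolding Q_def[abs_def] \<pi>_def[abs_def] .
    define F where "F = {S. S \<noteq> {} \<and> S \<subseteq> {..<n} \<and> sum \<pi> S \<le> 1 / 2}"
    define \<phi> where "\<phi> = edge_expansion R"
    have \<phi>: "\<phi> = Min ((\<lambda>S. flow S / sum \<pi> S) ` F)"
      using True R unfolding \<phi>_def edge_expansion_def q_def[symmetric]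
      by (simp add: edge_expansion_wrt_def flow_def F_def Q_def \<pi>_def a_def b_def case_prod_beta)
    have "finite F" by (rule finite_subset[of _ "Pow {..<n}"]) (auto simp: F_def)
    moreover have "F \<noteq> {}" unfolding F_def by (rule expansion_family_nonempty[OF n])
    ultimately have "\<phi> \<in> (\<lambda>S. flow S / sum \<pi> S) ` F" unfolding \<phi> by (intro Min_in) auto
    then obtain S where S: "S \<in> F" "\<phi> = flow S / sum \<pi> S" by blast
    have \<phi>_le: "\<phi> * sum \<pi> T \<le> flow T" if "T \<noteq> {}" "T \<subseteq> {..<n}" "sum \<pi> T \<le> 1 / 2" for T
    proof -
      have "\<phi> \<le> flow T / sum \<pi> T"
        unfolding \<phi> using \<open>finite F\<close> that by (intro Min_le) (auto simp: F_def)
      then show ?thesis using mass_pos[OF that(2,1)] by (simp add: pos_le_divide_eq)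
    qed
    have \<phi>0: "0 \<le> \<phi>"
      unfolding S(2) using S(1) flow_nonneg[of S] mass_pos[of S] by (simp add: F_def)
    have ev: "left_eigenvector R a 1" "right_eigenvector R b 1"
      and pos: "positive_vec a" "positive_vec b"
      using ab by (auto simp: positive_eigenpair_def)
    note a = left_eigenvector_sum[OF R ev(1)] and b = right_eigenvector_sum[OF R ev(2)]
    have a0: "a $ i \<noteq> 0" and b0: "b $ i \<noteq> 0" if "i < n" for i
      using pos a(1) b(1) that by (auto simp: positive_vec_def)
    have "\<phi>\<^sup>2 \<le> 2 * \<gamma>"
    proof -
      obtain y where y: "\<exists>i<n. y i \<noteq> 0" "\<forall>i<n. (\<Sum>m<n. complex_of_real (r i m) * y m) = ls ! 1 * y i"
        "(\<Sum>i<n. complex_of_real (a $ i) * y i) = 0"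
        using second_eigenvector[of "\<lambda>i. a $ i"] n a(2) unfolding r_def by blast
      \<comment> \<open>\<open>P\<close> is R conjugated by the diagonal matrix of \<open>b\<close>.
        Division by \<open>b\<close> thus carries eigenvectors of R to those of \<open>P\<close>,
        and annihilation by \<open>a\<close> to mean zero under \<pi>.\<close>
      define f where "f i = y i / of_real (b $ i)" for i
      have bf: "of_real (b $ i) * f i = y i" if "i < n" for i using b0[OF that] by (simp add: f_def)
      have Qf: "(\<Sum>j<n. of_real (Q i j) * f j) = ls ! 1 * (of_real (\<pi> i) * f i)" if i: "i < n" for i
      proof -
        have "(\<Sum>j<n. of_real (Q i j) * f j) = (\<Sum>j<n. of_real (a $ i) * (of_real (r i j) * y j))"
          by (intro sum.cong refl) (simp add: Q_def r_def bf[symmetric] mult_ac)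
        also have "\<dots> = of_real (a $ i) * (ls ! 1 * y i)"
          unfolding sum_distrib_left[symmetric] using y(2) i by simp
        finally show ?thesis using bf[OF i] by (simp add: \<pi>_def mult_ac)
      qed
      have mean: "(\<Sum>i<n. of_real (\<pi> i) * f i) = 0"
      proof -
        have "(\<Sum>i<n. of_real (\<pi> i) * f i) = (\<Sum>i<n. complex_of_real (a $ i) * y i)"
          by (intro sum.cong refl) (simp add: \<pi>_def bf[symmetric] mult_ac)
        then show ?thesis using y(3) by simp
      qed
      have meanRe: "(\<Sum>i<n. \<pi> i * Re (f i)) = 0" and meanIm: "(\<Sum>i<n. \<pi> i * Im (f i)) = 0"
        using arg_cong[OF mean, of Re] arg_cong[OF mean, of Im] by simp_all
      let ?N = "\<lambda>f. \<Sum>i<n. \<pi> i * (f i)\<^sup>2"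
      let ?E = "\<lambda>f. \<Sum>i<n. \<Sum>j<n. Q i j * f i * f j"
      \<comment> \<open>\<open>Q\<close> is real, so no mixed terms appear, and the two energies
        together have quotient exactly 1 - \<gamma>. Hence the real or the imaginary part reaches
        it.\<close>
      have "Re (\<Sum>i<n. cnj (f i) * (\<Sum>j<n. of_real (Q i j) * f j))
          = ?E (\<lambda>i. Re (f i)) + ?E (\<lambda>i. Im (f i))"
        unfolding sum_distrib_left Re_sum sum.distrib[symmetric]
        by (intro sum.cong refl) (simp add: algebra_simps)
      moreover have "Re (\<Sum>i<n. cnj (f i) * (\<Sum>j<n. of_real (Q i j) * f j))
          = Re (ls ! 1) * (?N (\<lambda>i. Re (f i)) + ?N (\<lambda>i. Im (f i)))"
      proof -
        have "(\<Sum>i<n. cnj (f i) * (\<Sum>j<n. of_real (Q i j) * f j))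
            = (\<Sum>i<n. ls ! 1 * of_real (\<pi> i * (cmod (f i))\<^sup>2))"
          using Qf by (intro sum.cong refl) (simp add: complex_norm_square mult_ac del: of_real_power)
        also have "\<dots> = ls ! 1 * of_real (?N (\<lambda>i. Re (f i)) + ?N (\<lambda>i. Im (f i)))"
          unfolding sum_distrib_left[symmetric] of_real_sum[symmetric] sum.distrib[symmetric]
          by (simp add: cmod_power2 distrib_left)
        finally show ?thesis by simp
      qed
      ultimately have E: "?E (\<lambda>i. Re (f i)) + ?E (\<lambda>i. Im (f i))
          = (1 - \<gamma>) * ?N (\<lambda>i. Re (f i)) + (1 - \<gamma>) * ?N (\<lambda>i. Im (f i))"
        by (simp add: \<gamma>_def distrib_left)
      have part: "\<phi>\<^sup>2 \<le> 2 * \<gamma>"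
        if "(\<Sum>i<n. \<pi> i * g i) = 0" "\<exists>i<n. g i \<noteq> 0" "(1 - \<gamma>) * ?N g \<le> ?E g" for g
        by (rule cheeger[of g]) (use that \<phi>_le \<phi>0 in auto)
      have zero: "?N g = 0 \<and> ?E g = 0" if "\<not> (\<exists>i<n. g i \<noteq> 0)" for g
        using that by simp
      have f0: "\<exists>i<n. f i \<noteq> 0" using y(1) b0 by (auto simp: f_def)
      show ?thesis
      proof (cases "(\<exists>i<n. Re (f i) \<noteq> 0) \<and> (1 - \<gamma>) * ?N (\<lambda>i. Re (f i)) \<le> ?E (\<lambda>i. Re (f i))")
        case True
        then show ?thesis using part[OF meanRe] by blast
      next
        case Re: False
        have "(\<exists>i<n. Im (f i) \<noteq> 0) \<and> (1 - \<gamma>) * ?N (\<lambda>i. Im (f i)) \<le> ?E (\<lambda>i. Im (f i))"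
        proof (cases "\<exists>i<n. Re (f i) \<noteq> 0")
          case True
          then have lt: "?E (\<lambda>i. Re (f i)) < (1 - \<gamma>) * ?N (\<lambda>i. Re (f i))" using Re by auto
          then have Im: "(1 - \<gamma>) * ?N (\<lambda>i. Im (f i)) < ?E (\<lambda>i. Im (f i))" using E by linarith
          have "\<exists>i<n. Im (f i) \<noteq> 0"
          proof (rule ccontr)
            assume "\<not> ?thesis"
            from zero[of "\<lambda>i. Im (f i)", OF this] show False using Im by simp
          qed
          then show ?thesis using Im by auto
        next
          case False
          then have "\<exists>i<n. Im (f i) \<noteq> 0" using f0 by (auto simp: complex_eq_iff)
          moreover have "(1 - \<gamma>) * ?N (\<lambda>i. Im (f i)) = ?E (\<lambda>i. Im (f i))"
          proof -
            from zero[of "\<lambda>i. Re (f i)", OF False] show ?thesis using E by simp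
          qed
          ultimately show ?thesis by auto
        qed
        then show ?thesis using part[OF meanIm] by blast
      qed
    qed
    then have upper: "\<phi> \<le> sqrt (2 * \<gamma>)" by (rule real_le_rsqrt)
    have "1 / 30 * (\<gamma> / (real n + ln (1 / \<kappa>))) \<le> \<phi>" if \<kappa>: "\<kappa> > 0"
    proof (cases "\<gamma> = 0")
      case True
      then show ?thesis using \<phi>0 by simp
    next
      case False
      then have \<gamma>: "0 < \<gamma>" using \<gamma>0 by simp
      \<comment> \<open>The same conjugation transports the Schur basis: columns are divided by
        \<open>b\<close>, the dual family is multiplied by it, and \<open>B\<close> is
        unchanged.\<close>
      have lower: "\<gamma> / (28 * real n) * sum \<pi> S \<le> flow S"
      proof (rule expansion_lower_bound[where p = "\<lambda>j i. p j i / of_real (b $ i)"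
            and Y = "\<lambda>j i. Y j i * of_real (b $ i)" and B = B])
        fix j l assume jl: "j < n" "l < n"
        have "(\<Sum>i<n. Y j i * of_real (b $ i) * (p l i / of_real (b $ i))) = (\<Sum>i<n. Y j i * p l i)"
          using b0 by (intro sum.cong refl) simp
        then show "(\<Sum>i<n. Y j i * of_real (b $ i) * (p l i / of_real (b $ i))) = (if j = l then 1 else 0)"
          using dual[OF jl] by simp
      next
        fix i m assume im: "i < n" "m < n"
        have "(\<Sum>j<n. p j i / of_real (b $ i) * (Y j m * of_real (b $ m)))
            = of_real (b $ m / b $ i) * (\<Sum>j<n. p j i * Y j m)"
          by (simp add: sum_distrib_left mult_ac)
        then show "(\<Sum>j<n. p j i / of_real (b $ i) * (Y j m * of_real (b $ m))) = (if i = m then 1 else 0)"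
          using dual'[OF im] b0[OF im(1)] by auto
      next
        fix i j assume ij: "i < n" "j < n"
        have "(\<Sum>m<n. complex_of_real (Q i m / \<pi> i) * (p j m / of_real (b $ m)))
            = (\<Sum>m<n. of_real (r i m) * p j m) / of_real (b $ i)"
          unfolding sum_divide_distrib using ij a0 b0
          by (intro sum.cong refl) (simp add: Q_def \<pi>_def r_def field_simps)
        then show "(\<Sum>m<n. complex_of_real (Q i m / \<pi> i) * (p j m / of_real (b $ m)))
            = (\<Sum>l<n. B l j * (p l i / of_real (b $ i)))"
          unfolding triangular[OF ij] by (simp add: sum_divide_distrib)
      next
        fix j assume "1 \<le> j" "j < n"
        then show "Re (B j j) \<le> 1 - \<gamma>" using gap diag by simp
      qed (use tri \<gamma> S(1) in \<open>auto simp: F_def\<close>)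
      have "u \<bullet> v = 1" using assms(8) \<kappa> by blast
      then have uv: "(\<Sum>i<n. u $ i * v $ i) = 1"
        using right_eigenvector_sum(1)[OF R assms(6)] by (simp add: scalar_prod_def lessThan_atLeast0)
      \<comment> \<open>The products are positive and sum to 1, so \<kappa> \<le> 1 and the
        logarithm only enlarges the denominator.\<close>
      have "0 < u $ i * v $ i" if "i < n" for i using \<kappa>_le[OF that] \<kappa> by linarith
      then have "u $ 0 * v $ 0 \<le> (\<Sum>i<n. u $ i * v $ i)"
        using n by (intro member_le_sum) (auto intro: less_imp_le)
      then have "\<kappa> \<le> 1" using \<kappa>_le[of 0] n uv by linarith
      then have "0 \<le> ln (1 / \<kappa>)" using \<kappa> by (intro ln_ge_zero) simp
      then have "1 / 30 * (\<gamma> / (real n + ln (1 / \<kappa>))) \<le> 1 / 28 * (\<gamma> / real n)"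
        using \<gamma> n by (intro mult_mono divide_left_mono) auto
      also have "\<dots> = \<gamma> / (28 * real n)" by simp
      also have "\<dots> \<le> \<phi>"
        unfolding S(2) using lower mass_pos[of S] S(1) by (simp add: F_def pos_le_divide_eq)
      finally show ?thesis .
    qed
    then show ?thesis using upper \<phi>0 by (simp add: \<phi>_def \<gamma>_def)
  next
    case False
    then have \<phi>: "edge_expansion R = 0" unfolding edge_expansion_def by (simp only: if_False)
    \<comment> \<open>The expansion is 0 here, so the lower bound can only hold if its numerator
      vanishes.\<close>
    have "\<gamma> = 0" if \<kappa>: "\<kappa> > 0"
    proof (rule ccontr)
      assume "\<gamma> \<noteq> 0"
      then have \<gamma>: "0 < \<gamma>" using \<gamma>0 by simp
      note us = left_eigenvector_sum[OF R assms(5)] and vs = right_eigenvector_sum[OF R assms(6)]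
      have "u \<bullet> v = 1" using assms(8) \<kappa> by blast
      then have uv: "(\<Sum>i<n. u $ i * v $ i) = 1"
        using vs(1) by (simp add: scalar_prod_def lessThan_atLeast0)
      have "\<exists>\<alpha>. \<forall>i<n. \<bar>v $ i\<bar> \<le> \<alpha> * v $ i"
      proof (rule fixed_vector_constant_sign[of "\<lambda>i. v $ i" "\<lambda>i. u $ i"])
        show "0 \<le> r i j" if "i < n" "j < n" for i j
          using nonneg R that by (simp add: r_def nonneg_matrix_def)
        show "Re (ls ! j) < 1" if "1 \<le> j" "j < n" for j using gap[OF that] \<gamma> by linarith
      qed (use n norm us(2) vs(2) uv in \<open>auto simp: r_def\<close>)
      then obtain \<alpha> where \<alpha>: "\<forall>i<n. \<bar>v $ i\<bar> \<le> \<alpha> * v $ i" by blast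
      have uv0: "0 < u $ i * v $ i" if "i < n" for i using \<kappa>_le[OF that] \<kappa> by linarith
      \<comment> \<open>No \<open>v $ i\<close> is zero, so all have the sign of \<alpha>, and
        \<open>u $ i * v $ i\<close> > 0 passes this sign on to \<open>u\<close>. Scaling both
        vectors by it would give a positive pair.\<close>
      have sign: "0 < sgn \<alpha> * v $ i \<and> 0 < sgn \<alpha> * u $ i" if i: "i < n" for i
      proof -
        have "v $ i \<noteq> 0" using uv0[OF i] by auto
        then have "0 < \<alpha> * v $ i" using \<alpha> i by (meson less_le_trans zero_less_abs_iff)
        then show ?thesis using uv0[OF i] by (auto simp: zero_less_mult_iff sgn_if)
      qed
      have sgn0: "sgn \<alpha> \<noteq> 0" using sign[of 0] n by auto
      have "left_eigenvector R (sgn \<alpha> \<cdot>\<^sub>v u) 1"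
        using eigenvector_smult[of "transpose_mat R" n u 1] R sgn0 assms(5)
        by (simp add: left_eigenvector_def)
      moreover have "right_eigenvector R (sgn \<alpha> \<cdot>\<^sub>v v) 1"
        using eigenvector_smult[of R n v 1] R sgn0 assms(6) by (simp add: right_eigenvector_def)
      ultimately have "positive_eigenpair R (sgn \<alpha> \<cdot>\<^sub>v u, sgn \<alpha> \<cdot>\<^sub>v v)"
        using sign us(1) vs(1) by (auto simp: positive_eigenpair_def positive_vec_def)
      then show False using False by blast
    qed
    then show ?thesis using \<phi> \<gamma>0 by (simp add: \<gamma>_def)
  qed
qed

end
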